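(* Let $\Gamma$ be a metric graph, $D$ an effective divisor on $\Gamma$, and $\Sigma\subseteq R(D)$. If $(D,\Sigma)$ is a strongly recursive tropical linear series of rank $r$, then $(D,\Sigma)$ is a combinatorial limit linear series of rank $r$.
   Context: Metric graphs and functions. A metric graph $\Gamma$ is obtained from a finite connected graph by identifying each edge with a closed real interval of positive finite length. For $v\in\Gamma$, $T_v(\Gamma)$ is the set of outgoing tangent directions at $v$, and $\mathrm{val}(v)=|T_v(\Gamma)|$. A divisor is a finitely supported formal sum $D=\sum_{v\in\Gamma}D(v)\cdot v$ with $D(v)\in\mathbb Z$. It is effective ($D\ge 0$) if all $D(v)\ge0$. We write $\mathrm{supp}(D)=\{v:D(v)\neq0\}$ and $\deg D=\sum_v D(v)$. $\mathrm{PL}(\Gamma)$ is the set of continuous piecewise linear functions $\Gamma\to\mathbb R$ with integer slopes. For $\eta\in T_v(\Gamma)$, $\mathrm{sl}_\eta(f)$ is the outgoing slope of $f$ at $v$ along $\eta$. Set $\mathrm{ord}_v(f)=-\sum_{\eta\in T_v(\Gamma)}\mathrm{sl}_\eta(f)$, $\mathrm{div}(f)=\sum_v\mathrm{ord}_v(f)\cdot v$, and $R(D)=\{f\in\mathrm{PL}(\Gamma):D+\mathrm{div}(f)\ge0\}$. $\mathrm{PL}(\Gamma)$ carries the topology of the norm $\|f\|_\infty=\max_{x\in\Gamma}|f(x)|$. Tropical submodules. A tropical linear combination of $f_1,\dots,f_k$ is $\min\{f_1+a_1,\dots,f_k+a_k\}$ with $a_i\in\mathbb R$. A tropical submodule is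 a subset of $\mathrm{PL}(\Gamma)$ closed under tropical linear combinations. It is finitely generated if it equals the set $\langle f_1,\dots,f_n\rangle$ of all tropical linear combinations of finitely many functions. Functions $f_1,\dots,f_k$ are tropically dependent if there exist $a_1,\dots,a_k\in\mathbb R$ such that at every $x\in\Gamma$ the minimum $\min_i(f_i(x)+a_i)$ is attained by at least two indices $i$. Tropical linear series. Let $\Sigma\subseteq R(D)$ be a finitely generated tropical submodule. $(D,\Sigma)$ is a tropical linear series of rank $r$ if: (1) for every effective divisor $E$ of degree $r$ there is $f\in\Sigma$ with $\mathrm{div}(f)+D\ge E$; (2) every set of $r+2$ functions in $\Sigma$ is tropically dependent. Strongly recursive tropical linear series. This is defined recursively in $r$. A tropical linear series $(D,\Sigma)$ of rank $r$ is strongly recursive if: (3) every set of $r$ functions in $\Sigma$ is contained in some $\Sigma'\subseteq\Sigma$ such that $(D,\Sigma')$ is a strongly recursive tropical linear series of rank $r-1$ (vacuous for $r=0$); (4) if $S_1,S_2\subseteq\Sigma$ have sizes $s_1,s_2\le r$ with $s_1+s_2\ge r+2$, then there are $\Sigma_1\supseteq S_1$ and $\Sigma_2\supseteq S_2$, contained in $\Sigma$, which are strongly recursive tropical linear series of ranks $s_1-1$ and $s_2-1$, such that $\Sigma_1\cap\Sigma_2$ contains a strongly recursive tropical linear series of rank $s_1+s_2-r-2$. Dot arrays. Let $[r]=\{0,1,\dots,r\}$. A dot array is a subset $P\subseteq[r]^d$. Order $[r]^d$ by $\mathbf x\preceq\mathbf y$ iff $x_i\le y_i$ for all $i$, with meet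 $\mathbf x\wedge\mathbf y=(\min(x_i,y_i))_i$. The principal subarray is $P[\mathbf x]=\{\mathbf y\in P:\mathbf y\succeq\mathbf x\}$. Let $\mathrm{rk}_iP$ be one less than the number of distinct values of the $i$-th coordinate among elements of $P$. $P$ is rankable of rank $s$ if $\mathrm{rk}_iP=s$ for all $i$. $P$ is totally rankable if every principal subarray is rankable; its rank array is $\rho_P(\mathbf x)=\mathrm{rank}\,P[\mathbf x]$. A point $\mathbf x\in[r]^d$ is redundant for $P$ if $\mathbf x=\bigwedge\mathcal H$ for some $\mathcal H\subseteq P$ with $|\mathcal H|\ge2$ such that every member of $\mathcal H$ has at least one coordinate in common with $\mathbf x$. $R(P)$ denotes the set of redundant points. A permutation array of rank $r$ and dimension $d$ is a totally rankable $P\subseteq[r]^d$ of rank $r$ containing none of its redundant points. Its redundant closure is $\overline P=P\cup R(P)$. The standard permutation array of rank $r$ and dimension $d$ is $\{\mathbf x\in[r]^d:\sum_ix_i=r\}$. Slope structures. Let $V\subset\Gamma$ be finite and contain all points of valence $\ne2$. An $r$-slope structure $\mathfrak S$ on $(\Gamma,V)$ consists of: - for each tangent vector $\eta$, integers $s^\eta_0<\dots<s^\eta_r$; - for each $v\in\Gamma$, an ordering $\eta_1,\dots,\eta_{\mathrm{val}(v)}$ of $T_v(\Gamma)$; - for each $v$, a permutation array $P_v$ of rank $r$ and dimension $\mathrm{val}(v)$. These data satisfy: - on each connected component of $\Gamma\setminus V$, the sets $S^\eta$ are constant for tangent vectors pointing in the same direction, and $s^\eta_i+s^\xi_{r-i}=0$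 for opposite directions $\eta,\xi$; - for $v\notin V$, $P_v$ is the standard permutation array of rank $r$ and dimension $2$. A function $f\in\mathrm{PL}(\Gamma)$ is compatible with $\mathfrak S$ if $\mathrm{sl}_\eta(f)\in S^\eta$ for all $\eta$, and for every $v$ the vector $\partial_v(f)=(j_1,\dots,j_{\mathrm{val}(v)})$ defined by $\mathrm{sl}_{\eta_k}(f)=s^{\eta_k}_{j_k}$ lies in $\overline{P_v}$. In that case $\rho_v(f)=\rho_{P_v}(\partial_v(f))$. Write $R(D,\mathfrak S)$ for the set of $f\in R(D)$ compatible with $\mathfrak S$. Combinatorial limit linear series. For an effective divisor $E$, $f$ satisfies (BNRP) for $E$ if $\mathrm{div}(f)+D\ge E$, and (LRP) for $E$ if $\rho_v(f)\ge E(v)$ for all $v$. A tropical submodule $\Sigma\subseteq R(D)$ is admissible of rank $r$ if: - $\Sigma$ is closed in the $\|\cdot\|_\infty$ topology; - $\Sigma\subseteq R(D,\mathfrak S)$ for some $r$-slope structure $\mathfrak S$; - for every effective $E$ of degree $r$ some $f\in\Sigma$ satisfies (BNRP) and (LRP) for $E$ (with respect to $\mathfrak S$). A combinatorial limit linear series of rank $r$ is a pair $(D,\Sigma)$ with $\Sigma\subseteq R(D)$ a finitely generated admissible submodule of rank $r$ such that every $r+2$ elements of $\Sigma$ are tropically dependent. *)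

theory Defs
  imports "HOL-Analysis.Analysis"
begin

section \<open>Metric graphs (concrete combinatorial model)\<close>

text \<open>A metric graph is given by a finite connected multigraph (loops and multiple
edges allowed) whose edges e carry lengths; edge e is identified with the interval
[0, elen e], parameter 0 at the tail etl e and parameter elen e at the head ehd e.\<close>

record ('v,'e) mgraph =
  verts :: "'v set"
  edges :: "'e set"
  etl   :: "'e \<Rightarrow> 'v"
  ehd   :: "'e \<Rightarrow> 'v"
  elen  :: "'e \<Rightarrow> real"

definition metric_graph :: "('v,'e) mgraph \<Rightarrow> bool" where
  "metric_graph G \<longleftrightarrow>
     finite (verts G) \<and> verts G \<noteq> {} \<and> finite (edges G) \<and> edges G \<noteq> {} \<and>
     (\<forall>e\<in>edges G. etl G e \<in> verts G \<and> ehd G e \<in> verts G \<and> 0 < elen G e) \<and>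
     (\<forall>u\<in>verts G. \<forall>w\<in>verts G.
        (u, w) \<in> ({(etl G e, ehd G e) | e. e \<in> edges G} \<union>
                  {(ehd G e, etl G e) | e. e \<in> edges G})\<^sup>*)"

text \<open>Points of the metric graph: vertices, and interior points of edges.\<close>
datatype ('v,'e) gpt = GV 'v | GE 'e real

definition pts :: "('v,'e) mgraph \<Rightarrow> ('v,'e) gpt set" where
  "pts G = GV ` verts G \<union> {GE e t | e t. e \<in> edges G \<and> 0 < t \<and> t < elen G e}"

text \<open>Tangent vectors: (base point, b, e); b = True means pointing in the direction of
increasing parameter along e, b = False decreasing.\<close>
type_synonym ('v,'e) tang = "('v,'e) gpt \<times> bool \<times> 'e"

definition tang :: "('v,'e) mgraph \<Rightarrow> ('v,'e) gpt \<Rightarrow> ('v,'e) tang set" where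
  "tang G x = (case x of
      GV v \<Rightarrow> {(x, True, e) | e. e \<in> edges G \<and> etl G e = v} \<union>
              {(x, False, e) | e. e \<in> edges G \<and> ehd G e = v}
    | GE e t \<Rightarrow> {(x, True, e), (x, False, e)})"

definition val :: "('v,'e) mgraph \<Rightarrow> ('v,'e) gpt \<Rightarrow> nat" where
  "val G x = card (tang G x)"

text \<open>The function f read along edge e as a function of the parameter.\<close>
definition efun :: "('v,'e) mgraph \<Rightarrow> (('v,'e) gpt \<Rightarrow> real) \<Rightarrow> 'e \<Rightarrow> real \<Rightarrow> real" where
  "efun G f e t = (if t \<le> 0 then f (GV (etl G e))
                   else if elen G e \<le> t then f (GV (ehd G e)) else f (GE e t))"

definition tpos :: "('v,'e) mgraph \<Rightarrow> ('v,'e) tang \<Rightarrow> real" where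
  "tpos G \<eta> = (case \<eta> of (GV v, b, e) \<Rightarrow> (if b then 0 else elen G e) | (GE e' t, b, e) \<Rightarrow> t)"

text \<open>Outgoing slope of f along a tangent vector.\<close>
definition slope :: "('v,'e) mgraph \<Rightarrow> (('v,'e) gpt \<Rightarrow> real) \<Rightarrow> ('v,'e) tang \<Rightarrow> real" where
  "slope G f \<eta> = (case \<eta> of (x, b, e) \<Rightarrow>
     Lim (at_right 0) (\<lambda>s. (efun G f e (tpos G \<eta> + (if b then s else - s)) - efun G f e (tpos G \<eta>)) / s))"

text \<open>PL(Gamma): continuous piecewise linear functions with integer slopes.  Functions
are represented canonically as 0 outside the points of the graph.\<close>
definition is_PL :: "('v,'e) mgraph \<Rightarrow> (('v,'e) gpt \<Rightarrow> real) \<Rightarrow> bool" where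
  "is_PL G f \<longleftrightarrow> (\<forall>x. x \<notin> pts G \<longrightarrow> f x = 0) \<and>
     (\<forall>e\<in>edges G. \<exists>ts :: real list. sorted_wrt (<) ts \<and> 2 \<le> length ts \<and>
        hd ts = 0 \<and> last ts = elen G e \<and>
        (\<forall>i. Suc i < length ts \<longrightarrow>
           (\<exists>m :: int. \<exists>c :: real. \<forall>t\<in>{ts ! i .. ts ! Suc i}. efun G f e t = of_int m * t + c)))"

definition PL :: "('v,'e) mgraph \<Rightarrow> (('v,'e) gpt \<Rightarrow> real) set" where
  "PL G = {f. is_PL G f}"

definition ordv :: "('v,'e) mgraph \<Rightarrow> (('v,'e) gpt \<Rightarrow> real) \<Rightarrow> ('v,'e) gpt \<Rightarrow> real" where
  "ordv G f x = - (\<Sum>\<eta>\<in>tang G x. slope G f \<eta>)"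

section \<open>Divisors\<close>

definition is_divisor :: "('v,'e) mgraph \<Rightarrow> (('v,'e) gpt \<Rightarrow> int) \<Rightarrow> bool" where
  "is_divisor G D \<longleftrightarrow> finite {x. D x \<noteq> 0} \<and> {x. D x \<noteq> 0} \<subseteq> pts G"

definition effective :: "('v,'e) mgraph \<Rightarrow> (('v,'e) gpt \<Rightarrow> int) \<Rightarrow> bool" where
  "effective G D \<longleftrightarrow> is_divisor G D \<and> (\<forall>x. 0 \<le> D x)"

definition deg :: "(('v,'e) gpt \<Rightarrow> int) \<Rightarrow> int" where
  "deg D = (\<Sum>x\<in>{x. D x \<noteq> 0}. D x)"

text \<open>div(f) + D \<ge> E\<close>
definition bnrp :: "('v,'e) mgraph \<Rightarrow> (('v,'e) gpt \<Rightarrow> int) \<Rightarrow> (('v,'e) gpt \<Rightarrow> real)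
                     \<Rightarrow> (('v,'e) gpt \<Rightarrow> int) \<Rightarrow> bool" where
  "bnrp G D f E \<longleftrightarrow> (\<forall>x\<in>pts G. real_of_int (E x) \<le> real_of_int (D x) + ordv G f x)"

definition RD :: "('v,'e) mgraph \<Rightarrow> (('v,'e) gpt \<Rightarrow> int) \<Rightarrow> (('v,'e) gpt \<Rightarrow> real) set" where
  "RD G D = {f. is_PL G f \<and> (\<forall>x\<in>pts G. 0 \<le> real_of_int (D x) + ordv G f x)}"

section \<open>Tropical submodules\<close>

definition tcomb :: "('v,'e) mgraph \<Rightarrow> (('v,'e) gpt \<Rightarrow> real) set
                      \<Rightarrow> ((('v,'e) gpt \<Rightarrow> real) \<Rightarrow> real) \<Rightarrow> ('v,'e) gpt \<Rightarrow> real" where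
  "tcomb G F a = (\<lambda>x. if x \<in> pts G then Min ((\<lambda>f. f x + a f) ` F) else 0)"

definition tspan :: "('v,'e) mgraph \<Rightarrow> (('v,'e) gpt \<Rightarrow> real) set \<Rightarrow> (('v,'e) gpt \<Rightarrow> real) set" where
  "tspan G F = {tcomb G F a | a. True}"

definition trop_submodule :: "('v,'e) mgraph \<Rightarrow> (('v,'e) gpt \<Rightarrow> real) set \<Rightarrow> bool" where
  "trop_submodule G \<Sigma> \<longleftrightarrow> \<Sigma> \<subseteq> PL G \<and>
     (\<forall>F a. finite F \<and> F \<noteq> {} \<and> F \<subseteq> \<Sigma> \<longrightarrow> tcomb G F a \<in> \<Sigma>)"

definition fin_gen :: "('v,'e) mgraph \<Rightarrow> (('v,'e) gpt \<Rightarrow> real) set \<Rightarrow> bool" where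
  "fin_gen G \<Sigma> \<longleftrightarrow> (\<exists>F. finite F \<and> F \<noteq> {} \<and> F \<subseteq> PL G \<and> \<Sigma> = tspan G F)"

definition trop_dep :: "('v,'e) mgraph \<Rightarrow> (('v,'e) gpt \<Rightarrow> real) set \<Rightarrow> bool" where
  "trop_dep G F \<longleftrightarrow> (\<exists>a. \<forall>x\<in>pts G. \<exists>f\<in>F. \<exists>g\<in>F. f \<noteq> g \<and>
      f x + a f = Min ((\<lambda>h. h x + a h) ` F) \<and> g x + a g = Min ((\<lambda>h. h x + a h) ` F))"

section \<open>Tropical linear series\<close>

definition TLS :: "('v,'e) mgraph \<Rightarrow> (('v,'e) gpt \<Rightarrow> int) \<Rightarrow> (('v,'e) gpt \<Rightarrow> real) set \<Rightarrow> nat \<Rightarrow> bool" where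
  "TLS G D \<Sigma> r \<longleftrightarrow> \<Sigma> \<subseteq> RD G D \<and> trop_submodule G \<Sigma> \<and> fin_gen G \<Sigma> \<and>
     (\<forall>E. effective G E \<and> deg E = int r \<longrightarrow> (\<exists>f\<in>\<Sigma>. bnrp G D f E)) \<and>
     (\<forall>S. S \<subseteq> \<Sigma> \<and> finite S \<and> card S = r + 2 \<longrightarrow> trop_dep G S)"

text \<open>Strongly recursive tropical linear series of rank r.\<close>
function SR :: "('v,'e) mgraph \<Rightarrow> (('v,'e) gpt \<Rightarrow> int) \<Rightarrow> nat \<Rightarrow> (('v,'e) gpt \<Rightarrow> real) set \<Rightarrow> bool" where
  "SR G D 0 \<Sigma> = TLS G D \<Sigma> 0"
| "SR G D (Suc r) \<Sigma> = (TLS G D \<Sigma> (Suc r) \<and>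
     (\<forall>S. S \<subseteq> \<Sigma> \<and> finite S \<and> card S = Suc r \<longrightarrow> (\<exists>\<Sigma>'. S \<subseteq> \<Sigma>' \<and> \<Sigma>' \<subseteq> \<Sigma> \<and> SR G D r \<Sigma>')) \<and>
     (\<forall>s1\<in>{..Suc r}. \<forall>s2\<in>{..Suc r}. Suc r + 2 \<le> s1 + s2 \<longrightarrow>
        (\<forall>S1 S2. S1 \<subseteq> \<Sigma> \<and> S2 \<subseteq> \<Sigma> \<and> finite S1 \<and> finite S2 \<and> card S1 = s1 \<and> card S2 = s2 \<longrightarrow>
           (\<exists>\<Sigma>1 \<Sigma>2. S1 \<subseteq> \<Sigma>1 \<and> \<Sigma>1 \<subseteq> \<Sigma> \<and> S2 \<subseteq> \<Sigma>2 \<and> \<Sigma>2 \<subseteq> \<Sigma> \<and>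
              SR G D (s1 - 1) \<Sigma>1 \<and> SR G D (s2 - 1) \<Sigma>2 \<and>
              (\<exists>\<Sigma>3. \<Sigma>3 \<subseteq> \<Sigma>1 \<inter> \<Sigma>2 \<and> SR G D (s1 + s2 - Suc r - 2) \<Sigma>3)))))"
  by pat_completeness auto
termination
  by (relation "Wellfounded.measure (\<lambda>(G, D, r, \<Sigma>). r)") auto

section \<open>Dot arrays (points of [r]^d as lists of length d)\<close>

definition grid :: "nat \<Rightarrow> nat \<Rightarrow> nat list set" where
  "grid r d = {x. length x = d \<and> (\<forall>i<d. x ! i \<le> r)}"

definition dle :: "nat list \<Rightarrow> nat list \<Rightarrow> bool" where
  "dle x y \<longleftrightarrow> length x = length y \<and> (\<forall>i<length x. x ! i \<le> y ! i)"

definition psub :: "nat list set \<Rightarrow> nat list \<Rightarrow> nat list set" where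
  "psub P x = {y\<in>P. dle x y}"

definition rk :: "nat \<Rightarrow> nat list set \<Rightarrow> int" where
  "rk i P = int (card ((\<lambda>y. y ! i) ` P)) - 1"

definition rankable :: "nat \<Rightarrow> nat list set \<Rightarrow> int \<Rightarrow> bool" where
  "rankable d P s \<longleftrightarrow> (\<forall>i<d. rk i P = s)"

definition totally_rankable :: "nat \<Rightarrow> nat \<Rightarrow> nat list set \<Rightarrow> bool" where
  "totally_rankable r d P \<longleftrightarrow> (\<forall>x\<in>grid r d. \<exists>s. rankable d (psub P x) s)"

text \<open>Rank array rho_P(x) = rank of P[x] (all coordinates agree for rankable arrays,
dimension d \<ge> 1, so coordinate 0 is used).\<close>
definition rank_arr :: "nat list set \<Rightarrow> nat list \<Rightarrow> int" where
  "rank_arr P x = rk 0 (psub P x)"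

definition meetset :: "nat \<Rightarrow> nat list set \<Rightarrow> nat list" where
  "meetset d H = map (\<lambda>i. Min ((\<lambda>h. h ! i) ` H)) [0..<d]"

definition redundant :: "nat \<Rightarrow> nat list set \<Rightarrow> nat list \<Rightarrow> bool" where
  "redundant d P x \<longleftrightarrow> (\<exists>H. H \<subseteq> P \<and> finite H \<and> 2 \<le> card H \<and> x = meetset d H \<and>
                              (\<forall>h\<in>H. \<exists>i<d. h ! i = x ! i))"

definition Rset :: "nat \<Rightarrow> nat list set \<Rightarrow> nat list set" where
  "Rset d P = {x. redundant d P x}"

definition perm_array :: "nat \<Rightarrow> nat \<Rightarrow> nat list set \<Rightarrow> bool" where
  "perm_array r d P \<longleftrightarrow> P \<subseteq> grid r d \<and> totally_rankable r d P \<and> rankable d P (int r) \<and>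
                         P \<inter> Rset d P = {}"

definition std_perm :: "nat \<Rightarrow> nat \<Rightarrow> nat list set" where
  "std_perm r d = {x\<in>grid r d. sum_list x = r}"

section \<open>Slope structures\<close>

text \<open>S eta i = s^eta_i; ordr x k = the (k+1)-st tangent direction at x; P x = P_x.
The condition that the slope sets are constant along each connected component of
Gamma minus V (for tangent vectors pointing in the same direction) is expressed as
local constancy along edges and through the (valence 2) vertices not in V.\<close>

definition Sset :: "nat \<Rightarrow> (('v,'e) tang \<Rightarrow> nat \<Rightarrow> int) \<Rightarrow> ('v,'e) tang \<Rightarrow> int set" where
  "Sset r S \<eta> = S \<eta> ` {0..r}"

definition slope_structure :: "('v,'e) mgraph \<Rightarrow> nat \<Rightarrow> ('v,'e) gpt set \<Rightarrow> (('v,'e) tang \<Rightarrow> nat \<Rightarrow> int)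
      \<Rightarrow> (('v,'e) gpt \<Rightarrow> nat \<Rightarrow> ('v,'e) tang) \<Rightarrow> (('v,'e) gpt \<Rightarrow> nat list set) \<Rightarrow> bool" where
  "slope_structure G r V S ordr P \<longleftrightarrow>
     finite V \<and> V \<subseteq> pts G \<and> (\<forall>x\<in>pts G. val G x \<noteq> 2 \<longrightarrow> x \<in> V) \<and>
     (\<forall>x\<in>pts G. \<forall>\<eta>\<in>tang G x. strict_mono_on {0..r} (S \<eta>)) \<and>
     (\<forall>x\<in>pts G. bij_betw (ordr x) {0..<val G x} (tang G x)) \<and>
     (\<forall>x\<in>pts G. perm_array r (val G x) (P x)) \<and>
     \<comment> \<open>constancy along components of Gamma minus V: interior points of edges\<close>
     (\<forall>e\<in>edges G. \<forall>t. 0 < t \<and> t < elen G e \<and> GE e t \<notin> V \<longrightarrow>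
        (\<forall>b. \<forall>\<^sub>F t' in at t. Sset r S (GE e t', b, e) = Sset r S (GE e t, b, e))) \<and>
     \<comment> \<open>... near the tail vertex of an edge, if it is not in V\<close>
     (\<forall>e\<in>edges G. GV (etl G e) \<notin> V \<longrightarrow>
        (\<forall>\<eta>\<in>tang G (GV (etl G e)). \<eta> \<noteq> (GV (etl G e), True, e) \<longrightarrow>
           (\<forall>\<^sub>F t in at_right 0. Sset r S (GE e t, True, e) = Sset r S (GV (etl G e), True, e) \<and>
                                 Sset r S (GE e t, False, e) = Sset r S \<eta>))) \<and>
     \<comment> \<open>... near the head vertex of an edge, if it is not in V\<close>
     (\<forall>e\<in>edges G. GV (ehd G e) \<notin> V \<longrightarrow>
        (\<forall>\<eta>\<in>tang G (GV (ehd G e)). \<eta> \<noteq> (GV (ehd G e), False, e) \<longrightarrow>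
           (\<forall>\<^sub>F t in at_left (elen G e). Sset r S (GE e t, False, e) = Sset r S (GV (ehd G e), False, e) \<and>
                                        Sset r S (GE e t, True, e) = Sset r S \<eta>))) \<and>
     \<comment> \<open>opposite directions\<close>
     (\<forall>x\<in>pts G - V. \<forall>\<eta>\<in>tang G x. \<forall>\<xi>\<in>tang G x. \<eta> \<noteq> \<xi> \<longrightarrow>
        (\<forall>i\<le>r. S \<eta> i + S \<xi> (r - i) = 0)) \<and>
     (\<forall>x\<in>pts G - V. P x = std_perm r 2)"

definition dvec :: "('v,'e) mgraph \<Rightarrow> nat \<Rightarrow> (('v,'e) tang \<Rightarrow> nat \<Rightarrow> int)
      \<Rightarrow> (('v,'e) gpt \<Rightarrow> nat \<Rightarrow> ('v,'e) tang) \<Rightarrow> (('v,'e) gpt \<Rightarrow> real) \<Rightarrow> ('v,'e) gpt \<Rightarrow> nat list" where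
  "dvec G r S ordr f x = map (\<lambda>k. THE j. j \<le> r \<and> real_of_int (S (ordr x k) j) = slope G f (ordr x k))
                             [0..<val G x]"

definition compatible :: "('v,'e) mgraph \<Rightarrow> nat \<Rightarrow> (('v,'e) tang \<Rightarrow> nat \<Rightarrow> int)
      \<Rightarrow> (('v,'e) gpt \<Rightarrow> nat \<Rightarrow> ('v,'e) tang) \<Rightarrow> (('v,'e) gpt \<Rightarrow> nat list set) \<Rightarrow> (('v,'e) gpt \<Rightarrow> real) \<Rightarrow> bool" where
  "compatible G r S ordr P f \<longleftrightarrow> is_PL G f \<and>
     (\<forall>x\<in>pts G. \<forall>\<eta>\<in>tang G x. slope G f \<eta> \<in> real_of_int ` S \<eta> ` {0..r}) \<and>
     (\<forall>x\<in>pts G. dvec G r S ordr f x \<in> P x \<union> Rset (val G x) (P x))"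

definition rho :: "('v,'e) mgraph \<Rightarrow> nat \<Rightarrow> (('v,'e) tang \<Rightarrow> nat \<Rightarrow> int)
      \<Rightarrow> (('v,'e) gpt \<Rightarrow> nat \<Rightarrow> ('v,'e) tang) \<Rightarrow> (('v,'e) gpt \<Rightarrow> nat list set) \<Rightarrow> (('v,'e) gpt \<Rightarrow> real)
      \<Rightarrow> ('v,'e) gpt \<Rightarrow> int" where
  "rho G r S ordr P f x = rank_arr (P x) (dvec G r S ordr f x)"

definition RDS :: "('v,'e) mgraph \<Rightarrow> (('v,'e) gpt \<Rightarrow> int) \<Rightarrow> nat \<Rightarrow> (('v,'e) tang \<Rightarrow> nat \<Rightarrow> int)
      \<Rightarrow> (('v,'e) gpt \<Rightarrow> nat \<Rightarrow> ('v,'e) tang) \<Rightarrow> (('v,'e) gpt \<Rightarrow> nat list set) \<Rightarrow> (('v,'e) gpt \<Rightarrow> real) set" where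
  "RDS G D r S ordr P = {f \<in> RD G D. compatible G r S ordr P f}"

section \<open>Combinatorial limit linear series\<close>

definition sup_closed :: "('v,'e) mgraph \<Rightarrow> (('v,'e) gpt \<Rightarrow> real) set \<Rightarrow> bool" where
  "sup_closed G \<Sigma> \<longleftrightarrow> (\<forall>fs g. (\<forall>n. fs n \<in> \<Sigma>) \<and> is_PL G g \<and>
       uniform_limit (pts G) fs g sequentially \<longrightarrow> g \<in> \<Sigma>)"

definition admissible :: "('v,'e) mgraph \<Rightarrow> (('v,'e) gpt \<Rightarrow> int) \<Rightarrow> nat \<Rightarrow> (('v,'e) gpt \<Rightarrow> real) set \<Rightarrow> bool" where
  "admissible G D r \<Sigma> \<longleftrightarrow> \<Sigma> \<subseteq> RD G D \<and> trop_submodule G \<Sigma> \<and> sup_closed G \<Sigma> \<and>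
     (\<exists>V S ordr P. slope_structure G r V S ordr P \<and> \<Sigma> \<subseteq> RDS G D r S ordr P \<and>
        (\<forall>E. effective G E \<and> deg E = int r \<longrightarrow>
           (\<exists>f\<in>\<Sigma>. bnrp G D f E \<and> (\<forall>x\<in>pts G. E x \<le> rho G r S ordr P f x))))"

definition CLLS :: "('v,'e) mgraph \<Rightarrow> (('v,'e) gpt \<Rightarrow> int) \<Rightarrow> nat \<Rightarrow> (('v,'e) gpt \<Rightarrow> real) set \<Rightarrow> bool" where
  "CLLS G D r \<Sigma> \<longleftrightarrow> \<Sigma> \<subseteq> RD G D \<and> fin_gen G \<Sigma> \<and> admissible G D r \<Sigma> \<and>
     (\<forall>S. S \<subseteq> \<Sigma> \<and> finite S \<and> card S = r + 2 \<longrightarrow> trop_dep G S)"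

end

(*
  Let F be a finite set of generators of Sigma.  Near a point x, each f in F is affine along every
  tangent direction, and the local behaviour of min (f + a f) at x is that of the generators
  attaining the minimum at x.

  Slopes: spreading r chips over distinct points close to x on one edge forces, by condition (1),
  r + 1 slopes in that direction; by condition (2) there are no more.  Hence every tropical linear
  series of rank r has exactly r + 1 slopes in every direction.

  Permutation arrays: let A be the set of slope vectors at x of the functions in Sigma.  For every
  threshold z, all tangent directions see the same number n of slopes among the functions whose
  slope vector is at least z.  This is proved by raising z one step at a time: when slopes are lost,
  condition (3) supplies a subseries of rank one less above the new threshold, and tropical
  dependence at x gives the upper bound.  Thus all principal subarrays of A are rankable, and then
  the points of A not dominated by a point of A sharing a coordinate form a permutation array whose
  redundant closure contains A.

  Ranks: for E of degree r, apply condition (1) to copies of E dispersed at distance less than 1/n,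
  and pass to a limit of the (normalized) coefficients.  The generators attaining the minimum near x
  before the limit attain it at x in the limit; so the limit function satisfies both (BNRP) and (LRP).
*)

theory Submission
  imports Defs
begin

section \<open>Nondominated points of a dot array\<close>

text \<open>Slope counts alone do not survive raising a threshold: the raise acts in one direction,
  while the counts in the other directions may change without control. What is carried along is a
  pair of certificates valid in all directions at once: a subseries of rank \<open>n - 1\<close> for
  the lower bound, dependence of any \<open>n + 1\<close> functions for the upper one. Dependence
  has to be localized at x, because a function of too small slope is excluded from a dependence only
  at the level of germs; elsewhere on the graph it may still matter.

  Chips placed at x itself would only bound a sum of slopes and say nothing about single slopes.
  Dispersed chips produce \<open>E x\<close> slopes strictly below the slope at x of the
  approximating function. In the limit all of these, and that slope itself, are attained at x, so
  one family of slopes yields both the drop for (BNRP) and the \<open>E x + 1\<close> values for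
  (LRP). One tangent direction per point suffices, since rankability makes all directions count
  alike.

  The finite set of special points consists of the vertices and the breakpoints of the generators.
  Elsewhere a combination is locally a minimum of affine functions, and its concavity leads to the
  standard arrays.\<close>

definition nondom :: "nat list set \<Rightarrow> nat list set" where
  "nondom A = {x\<in>A. \<not> (\<exists>y\<in>A. y \<noteq> x \<and> dle x y \<and> (\<exists>i<length x. y ! i = x ! i))}"

lemma finite_grid: "finite (grid r d)"
proof (rule finite_subset)
  show "grid r d \<subseteq> {x. set x \<subseteq> {..r} \<and> length x = d}"
    by (auto simp: grid_def in_set_conv_nth)
  show "finite {x::nat list. set x \<subseteq> {..r} \<and> length x = d}"
    by (rule finite_lists_length_eq) simp
qed

lemma dle_refl: "dle x x"
  by (simp add: dle_def)

lemma dle_trans: "dle x y \<Longrightarrow> dle y z \<Longrightarrow> dle x z"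
  by (fastforce simp: dle_def intro: le_trans)

lemma dle_sum_eq:
  assumes "dle w u" "(\<Sum>k<length w. u ! k) \<le> (\<Sum>k<length w. w ! k)"
  shows "u = w"
proof (rule nth_equalityI)
  show "length u = length w" using assms(1) by (simp add: dle_def)
  fix k assume "k < length u"
  then have k: "k < length w" using assms(1) by (simp add: dle_def)
  show "u ! k = w ! k"
  proof (rule ccontr)
    assume "u ! k \<noteq> w ! k"
    moreover have le: "\<And>k. k < length w \<Longrightarrow> w ! k \<le> u ! k" using assms(1) by (simp add: dle_def)
    ultimately have "w ! k < u ! k" using k by (simp add: le_neq_implies_less)
    then have "(\<Sum>k<length w. w ! k) < (\<Sum>k<length w. u ! k)"
      by (intro sum_strict_mono_ex1) (use le k in auto)
    with assms(2) show False by simp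
  qed
qed

text \<open>Choose w of maximal coordinate sum above y with the same i-th coordinate. If some
  \<open>y'\<close> dominated w and shared coordinate j, raising the i-th threshold past
  \<open>w ! i\<close> would lose a value of coordinate i, hence by rankability one of coordinate j.
  The lost value is not \<open>w ! j\<close>, which \<open>y'\<close> retains; so the point z that
  carried it differs from w, lies above w and keeps \<open>w ! i\<close>, against
  maximality.\<close>

lemma nondom_above:
  assumes A: "A \<subseteq> grid r d"
    and rkb: "\<And>x. length x = d \<Longrightarrow> \<exists>s. rankable d (psub A x) s"
    and y: "y \<in> A" and i: "i < d"
  shows "\<exists>w\<in>nondom A. dle y w \<and> w ! i = y ! i"
proof -
  define B where "B = {w\<in>A. dle y w \<and> w ! i = y ! i}"
  have finA: "finite A" using A finite_grid finite_subset by blast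
  then have "finite B" by (simp add: B_def)
  moreover have "y \<in> B" using y by (simp add: B_def dle_refl)
  ultimately have "Max ((\<lambda>u. \<Sum>k<d. u ! k) ` B) \<in> (\<lambda>u. \<Sum>k<d. u ! k) ` B"
    by (intro Max_in) auto
  then obtain w where wB: "w \<in> B" and "(\<Sum>k<d. w ! k) = Max ((\<lambda>u. \<Sum>k<d. u ! k) ` B)"
    by (metis (no_types, lifting) imageE)
  then have wmax: "\<And>u. u \<in> B \<Longrightarrow> (\<Sum>k<d. u ! k) \<le> (\<Sum>k<d. w ! k)"
    using \<open>finite B\<close> by simp
  have wA: "w \<in> A" and yw: "dle y w" and wi: "w ! i = y ! i" using wB by (auto simp: B_def)
  have lw: "length w = d" using wA A by (auto simp: grid_def)
  have wuniq: "u = w" if "u \<in> A" "dle w u" "u ! i = w ! i" for u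
    using that wmax[of u] lw wi dle_trans[OF yw] by (intro dle_sum_eq) (auto simp: B_def)
  have "w \<in> nondom A"
  proof (rule ccontr)
    assume "w \<notin> nondom A"
    then obtain y' j where y': "y' \<in> A" "y' \<noteq> w" "dle w y'" "j < d" "y' ! j = w ! j"
      using wA lw by (auto simp: nondom_def)
    have "y' ! i \<noteq> w ! i" using wuniq y' by blast
    then have y'i: "w ! i < y' ! i" using y'(3) i lw by (simp add: dle_def le_neq_implies_less)
    define w' where "w' = w[i := Suc (w ! i)]"
    have lw': "length w' = d" by (simp add: w'_def lw)
    have dw': "dle w' u \<longleftrightarrow> dle w u \<and> w ! i < u ! i" for u
      using i lw by (force simp: dle_def w'_def nth_list_update)
    have sub: "psub A w' \<subseteq> psub A w" by (auto simp: psub_def dw')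
    obtain s s' where s: "rankable d (psub A w) s" and s': "rankable d (psub A w') s'"
      using rkb lw lw' by blast
    have fin: "finite (psub A w)" using finA by (simp add: psub_def)
    let ?c = "\<lambda>k w. card ((\<lambda>y. y ! k) ` psub A w)"
    have "(\<lambda>y. y ! i) ` psub A w' \<subset> (\<lambda>y. y ! i) ` psub A w"
    proof -
      have "w ! i \<in> (\<lambda>y. y ! i) ` psub A w" using wA by (auto simp: psub_def dle_refl)
      moreover have "w ! i \<notin> (\<lambda>y. y ! i) ` psub A w'" by (auto simp: psub_def dw')
      ultimately show ?thesis using sub by blast
    qed
    then have "?c i w' < ?c i w" using fin by (intro psubset_card_mono) auto
    moreover have "rk i (psub A w) = rk j (psub A w)" "rk i (psub A w') = rk j (psub A w')"
      using s s' i y'(4) by (simp_all add: rankable_def)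
    then have "?c i w = ?c j w" "?c i w' = ?c j w'" by (simp_all add: rk_def)
    ultimately have "?c j w' < ?c j w" by simp
    then have "(\<lambda>y. y ! j) ` psub A w' \<noteq> (\<lambda>y. y ! j) ` psub A w" by auto
    then obtain z where z: "z \<in> psub A w" "z ! j \<notin> (\<lambda>y. y ! j) ` psub A w'" using sub by blast
    have "y' \<in> psub A w'" using y' y'i by (simp add: psub_def dw')
    then have "w ! j \<in> (\<lambda>y. y ! j) ` psub A w'" using imageI[of y' _ "\<lambda>y. y ! j"] y'(5) by simp
    then have "z ! j \<noteq> w ! j" using z(2) by metis
    moreover have "z ! i = w ! i"
    proof -
      have "z \<notin> psub A w'" using z(2) by blast
      then have "\<not> w ! i < z ! i" using z(1) by (auto simp: psub_def dw')
      moreover have "w ! i \<le> z ! i" using z(1) i lw by (auto simp: psub_def dle_def)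
      ultimately show ?thesis by simp
    qed
    ultimately show False using wuniq[of z] z(1) by (auto simp: psub_def)
  qed
  then show ?thesis using yw wi by blast
qed

text \<open>The nondominated points have the same ranks as the full array above every threshold:
  each value is retained by a nondominated point higher up.\<close>

lemma nondom_coord:
  assumes "A \<subseteq> grid r d" "\<And>x. length x = d \<Longrightarrow> \<exists>s. rankable d (psub A x) s" "i < d"
  shows "(\<lambda>y. y ! i) ` psub (nondom A) x = (\<lambda>y. y ! i) ` psub A x"
proof
  show "(\<lambda>y. y ! i) ` psub (nondom A) x \<subseteq> (\<lambda>y. y ! i) ` psub A x"
    by (auto simp: psub_def nondom_def)
  show "(\<lambda>y. y ! i) ` psub A x \<subseteq> (\<lambda>y. y ! i) ` psub (nondom A) x"
  proof
    fix u assume "u \<in> (\<lambda>y. y ! i) ` psub A x"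
    then obtain y where y: "y \<in> A" "dle x y" "u = y ! i" by (auto simp: psub_def)
    obtain w where "w \<in> nondom A" "dle y w" "w ! i = y ! i"
      using nondom_above[OF assms(1,2) y(1) assms(3)] by blast
    then have "w \<in> psub (nondom A) x" "w ! i = u"
      using y dle_trans[of x y w] by (simp_all add: psub_def)
    then show "u \<in> (\<lambda>y. y ! i) ` psub (nondom A) x" by blast
  qed
qed

text \<open>Ranks are inherited by \<open>nondom_coord\<close>. If x is the meet of at least two
  points that share coordinates with it, one of them differs from x and dominates it, so x cannot be
  nondominated.\<close>

lemma nondom_perm_array:
  assumes A: "A \<subseteq> grid r d"
    and rkb: "\<And>x. length x = d \<Longrightarrow> \<exists>s. rankable d (psub A x) s"
    and full: "\<And>i. i < d \<Longrightarrow> card ((\<lambda>y. y ! i) ` A) = Suc r"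
  shows "perm_array r d (nondom A)"
  unfolding perm_array_def
proof (intro conjI)
  have coord: "(\<lambda>y. y ! i) ` psub (nondom A) x = (\<lambda>y. y ! i) ` psub A x" if "i < d" for i x
    using nondom_coord[OF A _ that] rkb by blast
  show "nondom A \<subseteq> grid r d" using A by (auto simp: nondom_def)
  show "totally_rankable r d (nondom A)"
    using rkb by (auto simp: totally_rankable_def rankable_def rk_def coord grid_def)
  \<comment> \<open>The zero threshold excludes nothing, so the rank of the whole array is a special
    case of \<open>coord\<close>.\<close>
  have sub0: "psub B (replicate d 0) = B" if "B \<subseteq> A" for B
    using that A by (auto simp: psub_def dle_def grid_def)
  have "nondom A \<subseteq> A" by (auto simp: nondom_def)
  then have "(\<lambda>y. y ! i) ` nondom A = (\<lambda>y. y ! i) ` A" if "i < d" for i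
    using coord[OF that, of "replicate d 0"] sub0 by simp
  then show "rankable d (nondom A) (int r)" by (simp add: rankable_def rk_def full)
  show "nondom A \<inter> Rset d (nondom A) = {}"
  proof (rule ccontr)
    assume "nondom A \<inter> Rset d (nondom A) \<noteq> {}"
    then obtain x H where x: "x \<in> nondom A" and H: "H \<subseteq> nondom A" "finite H" "2 \<le> card H"
      "x = meetset d H" "\<forall>h\<in>H. \<exists>i<d. h ! i = x ! i"
      by (auto simp: Rset_def redundant_def)
    have "\<not> H \<subseteq> {x}" using H(3) card_mono[of "{x}" H] by auto
    then obtain h where h: "h \<in> H" "h \<noteq> x" by blast
    have "h \<in> A" using h H(1) by (auto simp: nondom_def)
    then have "length h = d" using A by (auto simp: grid_def)
    moreover have "length x = d" using H(4) by (simp add: meetset_def)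
    ultimately have "dle x h" using H(2,4) h(1) by (auto simp: dle_def meetset_def)
    then show False using x h H(5) \<open>h \<in> A\<close> \<open>length x = d\<close> by (auto simp: nondom_def)
  qed
qed

text \<open>A dominated x is the meet of nondominated points chosen above it, one agreeing with x in
  each coordinate. They are not all equal: a common value would agree with x everywhere, making x
  nondominated.\<close>

lemma nondom_closure:
  assumes A: "A \<subseteq> grid r d"
    and rkb: "\<And>x. length x = d \<Longrightarrow> \<exists>s. rankable d (psub A x) s"
    and "0 < d"
  shows "A \<subseteq> nondom A \<union> Rset d (nondom A)"
proof
  fix x assume x: "x \<in> A"
  have lx: "length x = d" using x A by (auto simp: grid_def)
  show "x \<in> nondom A \<union> Rset d (nondom A)"
  proof (cases "x \<in> nondom A")
    case False
    have "\<forall>i<d. \<exists>w. w \<in> nondom A \<and> dle x w \<and> w ! i = x ! i"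
      using nondom_above[OF A rkb x] by blast
    then obtain h where h: "\<And>i. i < d \<Longrightarrow> h i \<in> nondom A \<and> dle x (h i) \<and> h i ! i = x ! i"
      by metis
    define H where "H = h ` {..<d}"
    have "x = meetset d H"
    proof (rule nth_equalityI)
      show "length x = length (meetset d H)" by (simp add: meetset_def lx)
      fix i assume "i < length x"
      then have i: "i < d" by (simp add: lx)
      have "Min ((\<lambda>h. h ! i) ` H) = x ! i"
      proof (rule Min_eqI)
        show "finite ((\<lambda>h. h ! i) ` H)" by (simp add: H_def)
        show "\<And>y. y \<in> (\<lambda>h. h ! i) ` H \<Longrightarrow> x ! i \<le> y"
          using h i lx by (auto simp: H_def dle_def)
        show "x ! i \<in> (\<lambda>h. h ! i) ` H" using h[OF i] i unfolding H_def by (metis (no_types) imageI lessThan_iff)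
      qed
      then show "x ! i = meetset d H ! i" using i by (simp add: meetset_def)
    qed
    moreover have "2 \<le> card H"
    proof (rule ccontr)
      assume "\<not> 2 \<le> card H"
      moreover have "h 0 \<in> H" "finite H" using \<open>0 < d\<close> by (auto simp: H_def)
      ultimately have "card H = 1" using card_gt_0_iff[of H] by auto
      then obtain u where u: "H = {u}" by (auto simp: card_1_singleton_iff)
      then have "\<And>i. i < d \<Longrightarrow> h i = u" by (auto simp: H_def)
      then have "x = u" using h lx \<open>0 < d\<close>
        by (intro nth_equalityI) (auto simp: dle_def)
      then show False using False h[OF \<open>0 < d\<close>] \<open>\<And>i. i < d \<Longrightarrow> h i = u\<close> \<open>0 < d\<close> by auto
    qed
    ultimately have "redundant d (nondom A) x"
      unfolding redundant_def using h by (intro exI[of _ H]) (auto simp: H_def)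
    then show ?thesis by (simp add: Rset_def)
  qed simp
qed

text \<open>A point below the antidiagonal is dominated by the antidiagonal point with the same
  first coordinate. Nothing in \<open>A\<close> lies strictly above an antidiagonal point.\<close>

lemma nondom_std_perm:
  assumes std: "std_perm r 2 \<subseteq> A" and A: "A \<subseteq> grid r 2"
    and le: "\<And>x. x \<in> A \<Longrightarrow> x ! 0 + x ! 1 \<le> r"
  shows "nondom A = std_perm r 2"
proof -
  have two: "x = [x ! 0, x ! 1]" if "length x = 2" for x :: "nat list"
    using that by (intro nth_equalityI) (auto simp: less_2_cases_iff numeral_2_eq_2 nth_Cons split: nat.splits)
  have sum2: "sum_list x = x ! 0 + x ! 1" if "length x = 2" for x :: "nat list"
    by (subst two[OF that]) simp
  have dle2: "dle x y \<longleftrightarrow> x ! 0 \<le> y ! 0 \<and> x ! 1 \<le> y ! 1" if "length x = 2" "length y = 2" for x y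
    using that by (auto simp: dle_def less_2_cases_iff)
  have len: "length x = 2" if "x \<in> A" for x using A that by (auto simp: grid_def)
  show ?thesis
  proof
    show "nondom A \<subseteq> std_perm r 2"
    proof
      fix x assume x: "x \<in> nondom A"
      then have xA: "x \<in> A" by (simp add: nondom_def)
      define y where "y = [x ! 0, r - x ! 0]"
      have "y \<in> std_perm r 2"
        using A xA by (auto simp: std_perm_def grid_def y_def less_2_cases_iff)
      then have "y \<in> A" using std by blast
      moreover have "dle x y" using le[OF xA] len[OF xA] by (subst dle2) (auto simp: y_def)
      moreover have "y ! 0 = x ! 0" "0 < length x" using len[OF xA] by (auto simp: y_def)
      ultimately have "y = x" using x by (auto simp: nondom_def)
      then show "x \<in> std_perm r 2" using \<open>y \<in> std_perm r 2\<close> by simp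
    qed
    show "std_perm r 2 \<subseteq> nondom A"
    proof
      fix x assume x: "x \<in> std_perm r 2"
      then have xA: "x \<in> A" using std by blast
      have s: "x ! 0 + x ! 1 = r" using x sum2[OF len[OF xA]] by (simp add: std_perm_def)
      have "y = x" if "y \<in> A" "dle x y" for y
      proof -
        have "x ! 0 \<le> y ! 0" "x ! 1 \<le> y ! 1" using that len xA dle2 by auto
        then have "x ! 0 = y ! 0" "x ! 1 = y ! 1" using le[OF that(1)] s by auto
        then show "y = x" using two len that(1) xA by metis
      qed
      then show "x \<in> nondom A" using xA by (auto simp: nondom_def)
    qed
  qed
qed

section \<open>Germs of piecewise linear functions\<close>

text \<open>The result is always formed with \<open>GE\<close>, even if the base point is a vertex,
  and is a point of the graph only for small positive s. Statements about it are therefore eventual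
  in \<open>at_right 0\<close>.\<close>

definition along :: "('v,'e) mgraph \<Rightarrow> ('v,'e) tang \<Rightarrow> real \<Rightarrow> ('v,'e) gpt" where
  "along G \<eta> s = (case \<eta> of (x, b, e) \<Rightarrow> GE e (tpos G \<eta> + (if b then s else - s)))"

definition germ :: "('v,'e) mgraph \<Rightarrow> (('v,'e) gpt \<Rightarrow> real) \<Rightarrow> ('v,'e) tang \<Rightarrow> int \<Rightarrow> bool" where
  "germ G f \<eta> m \<longleftrightarrow> (\<forall>\<^sub>F s in at_right 0. f (along G \<eta> s) = f (fst \<eta>) + of_int m * s)"

text \<open>Slopes are real by definition; the floor gives them an integer type and is exact
  wherever a germ exists.\<close>

definition islope :: "('v,'e) mgraph \<Rightarrow> (('v,'e) gpt \<Rightarrow> real) \<Rightarrow> ('v,'e) tang \<Rightarrow> int" where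
  "islope G f \<eta> = \<lfloor>slope G f \<eta>\<rfloor>"

text \<open>The generators that attain the minimum at x. Pairwise comparison instead of
  \<open>Min\<close> lets inequalities between coefficients be read off directly.\<close>

definition Att :: "(('v,'e) gpt \<Rightarrow> real) set \<Rightarrow> ((('v,'e) gpt \<Rightarrow> real) \<Rightarrow> real)
    \<Rightarrow> ('v,'e) gpt \<Rightarrow> (('v,'e) gpt \<Rightarrow> real) set" where
  "Att F a x = {f\<in>F. \<forall>g\<in>F. f x + a f \<le> g x + a g}"

lemma eventually_at_right_0_less:
  assumes "0 < d"
  shows "\<forall>\<^sub>F s::real in at_right 0. 0 < s \<and> s < d"
  using eventually_at_right_real[OF assms] by eventually_elim auto

text \<open>Agreement arbitrarily close to 0 is all that the pigeonhole argument for tropical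
  dependence provides. Continuity identifies the values at 0, and then any common point identifies
  the slopes.\<close>

lemma frequently_affine_eq:
  fixes c c' m m' :: real
  assumes "\<exists>\<^sub>F s in at_right 0. c + m * s = c' + m' * s"
  shows "c = c'" "m = m'"
proof -
  show 1: "c = c'"
  proof (rule ccontr)
    assume ne: "c \<noteq> c'"
    have "((\<lambda>s. (c + m * s) - (c' + m' * s)) \<longlongrightarrow> (c + m * 0) - (c' + m' * 0)) (at_right 0)"
      by (intro tendsto_intros)
    then have "\<forall>\<^sub>F s in at_right 0. (c + m * s) - (c' + m' * s) \<noteq> 0"
      using ne by (intro tendsto_imp_eventually_ne) auto
    then show False using assms by (simp add: frequently_def)
  qed
  show "m = m'"
  proof (rule ccontr)
    assume "m \<noteq> m'"
    then have "\<forall>\<^sub>F s in at_right (0::real). c + m * s \<noteq> c' + m' * s"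
      using 1 by (auto intro: eventually_mono[OF eventually_at_right_less[of 0]])
    then show False using assms by (simp add: frequently_def)
  qed
qed

section \<open>Piecewise linear functions on a single edge\<close>

lemma bracketing_right:
  fixes t :: real
  assumes "2 \<le> length ts" "hd ts \<le> t" "t < last ts"
  shows "\<exists>i. Suc i < length ts \<and> ts ! i \<le> t \<and> t < ts ! Suc i"
proof -
  define j where "j = (LEAST j. j < length ts \<and> t < ts ! j)"
  have "ts \<noteq> []" using assms(1) by auto
  then have "\<exists>j. j < length ts \<and> t < ts ! j"
    using assms by (intro exI[of _ "length ts - 1"]) (auto simp: last_conv_nth)
  then have j: "j < length ts \<and> t < ts ! j" unfolding j_def by (rule LeastI_ex)
  then obtain i where i: "j = Suc i"
    using assms(2) \<open>ts \<noteq> []\<close> by (cases j) (auto simp: hd_conv_nth)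
  have "\<not> (i < length ts \<and> t < ts ! i)"
    using not_less_Least[of i "\<lambda>j. j < length ts \<and> t < ts ! j"] i unfolding j_def by auto
  then show ?thesis using j i by (intro exI[of _ i]) auto
qed

lemma bracketing_left:
  fixes t :: real
  assumes "2 \<le> length ts" "hd ts < t" "t \<le> last ts"
  shows "\<exists>i. Suc i < length ts \<and> ts ! i < t \<and> t \<le> ts ! Suc i"
proof -
  define j where "j = (LEAST j. j < length ts \<and> t \<le> ts ! j)"
  have "ts \<noteq> []" using assms(1) by auto
  then have "\<exists>j. j < length ts \<and> t \<le> ts ! j"
    using assms by (intro exI[of _ "length ts - 1"]) (auto simp: last_conv_nth)
  then have j: "j < length ts \<and> t \<le> ts ! j" unfolding j_def by (rule LeastI_ex)
  then obtain i where i: "j = Suc i"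
    using assms(2) \<open>ts \<noteq> []\<close> by (cases j) (auto simp: hd_conv_nth)
  have "\<not> (i < length ts \<and> t \<le> ts ! i)"
    using not_less_Least[of i "\<lambda>j. j < length ts \<and> t \<le> ts ! j"] i unfolding j_def by auto
  then show ?thesis using j i by (intro exI[of _ i]) auto
qed

lemma PL_pieces:
  assumes "is_PL G f" "e \<in> edges G"
  obtains ts :: "real list" where "2 \<le> length ts" "hd ts = 0" "last ts = elen G e"
    "\<And>i. Suc i < length ts \<Longrightarrow>
       \<exists>m :: int. \<exists>c :: real. \<forall>t\<in>{ts ! i .. ts ! Suc i}. efun G f e t = of_int m * t + c"
  using assms unfolding is_PL_def by blast

lemma PL_affine_right:
  assumes "is_PL G f" "e \<in> edges G" "0 \<le> t" "t < elen G e"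
  shows "\<exists>m :: int. \<forall>\<^sub>F s in at_right 0. efun G f e (t + s) = efun G f e t + of_int m * s"
proof -
  obtain ts :: "real list" where ts: "2 \<le> length ts" "hd ts = 0" "last ts = elen G e"
    "\<And>i. Suc i < length ts \<Longrightarrow>
       \<exists>m :: int. \<exists>c :: real. \<forall>t\<in>{ts ! i .. ts ! Suc i}. efun G f e t = of_int m * t + c"
    using PL_pieces[OF assms(1,2)] by blast
  obtain i where i: "Suc i < length ts" "ts ! i \<le> t" "t < ts ! Suc i"
    using bracketing_right[of ts t] ts assms by auto
  obtain m c where mc: "\<forall>t\<in>{ts ! i .. ts ! Suc i}. efun G f e t = of_int (m::int) * t + c"
    using ts(4)[OF i(1)] by blast
  have "\<forall>\<^sub>F s in at_right 0. 0 < s \<and> s < ts ! Suc i - t"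
    using i by (intro eventually_at_right_0_less) simp
  then have "\<forall>\<^sub>F s in at_right 0. efun G f e (t + s) = efun G f e t + of_int m * s"
    by eventually_elim (use mc i in \<open>auto simp: algebra_simps\<close>)
  then show ?thesis by blast
qed

lemma PL_affine_left:
  assumes "is_PL G f" "e \<in> edges G" "0 < t" "t \<le> elen G e"
  shows "\<exists>m :: int. \<forall>\<^sub>F s in at_right 0. efun G f e (t - s) = efun G f e t + of_int m * s"
proof -
  obtain ts :: "real list" where ts: "2 \<le> length ts" "hd ts = 0" "last ts = elen G e"
    "\<And>i. Suc i < length ts \<Longrightarrow>
       \<exists>m :: int. \<exists>c :: real. \<forall>t\<in>{ts ! i .. ts ! Suc i}. efun G f e t = of_int m * t + c"
    using PL_pieces[OF assms(1,2)] by blast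
  obtain i where i: "Suc i < length ts" "ts ! i < t" "t \<le> ts ! Suc i"
    using bracketing_left[of ts t] ts assms by auto
  obtain m c where mc: "\<forall>t\<in>{ts ! i .. ts ! Suc i}. efun G f e t = of_int (m::int) * t + c"
    using ts(4)[OF i(1)] by blast
  have "\<forall>\<^sub>F s in at_right 0. 0 < s \<and> s < t - ts ! i"
    using i by (intro eventually_at_right_0_less) simp
  then have "\<forall>\<^sub>F s in at_right 0. efun G f e (t - s) = efun G f e t + of_int (- m) * s"
    by eventually_elim (use mc i in \<open>auto simp: algebra_simps\<close>)
  then show ?thesis by blast
qed

lemma PL_breakpoints:
  assumes "is_PL G f" "e \<in> edges G"
  shows "\<exists>B. finite B \<and> (\<forall>t. 0 < t \<and> t < elen G e \<and> t \<notin> B \<longrightarrow>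
     (\<exists>m :: int. \<exists>c :: real. \<forall>\<^sub>F u in nhds t. f (GE e u) = of_int m * u + c))"
proof -
  obtain ts :: "real list" where ts: "2 \<le> length ts" "hd ts = 0" "last ts = elen G e"
    "\<And>i. Suc i < length ts \<Longrightarrow>
       \<exists>m :: int. \<exists>c :: real. \<forall>t\<in>{ts ! i .. ts ! Suc i}. efun G f e t = of_int m * t + c"
    using PL_pieces[OF assms] by blast
  have "\<exists>m :: int. \<exists>c :: real. \<forall>\<^sub>F u in nhds t. f (GE e u) = of_int m * u + c"
    if t: "0 < t" "t < elen G e" "t \<notin> set ts" for t
  proof -
    obtain i where i: "Suc i < length ts" "ts ! i \<le> t" "t < ts ! Suc i"
      using bracketing_right[of ts t] ts t by auto
    then have "ts ! i < t" using t(3) nth_mem[of i ts] by (cases "ts ! i = t") auto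
    obtain m c where mc: "\<forall>t\<in>{ts ! i .. ts ! Suc i}. efun G f e t = of_int (m::int) * t + c"
      using ts(4)[OF i(1)] by blast
    have "\<forall>\<^sub>F u in nhds t. u \<in> {ts ! i <..< ts ! Suc i} \<inter> {0 <..< elen G e}"
      by (rule eventually_nhds_in_open) (use \<open>ts ! i < t\<close> i t in auto)
    then have "\<forall>\<^sub>F u in nhds t. f (GE e u) = of_int m * u + c"
    proof eventually_elim
      case (elim u)
      then have "efun G f e u = f (GE e u)" by (auto simp: efun_def)
      then show ?case using mc elim by force
    qed
    then show ?thesis by blast
  qed
  then show ?thesis by (intro exI[of _ "set ts"]) auto
qed

lemma PL_bounded:
  assumes mg: "metric_graph G" and f: "is_PL G f"
  shows "bounded (f ` pts G)"
proof -
  have edge: "bounded (f ` {GE e t | t. 0 < t \<and> t < elen G e})" if e: "e \<in> edges G" for e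
  proof -
    obtain ts :: "real list" where ts: "2 \<le> length ts" "hd ts = 0" "last ts = elen G e"
      "\<And>i. Suc i < length ts \<Longrightarrow>
         \<exists>m :: int. \<exists>c :: real. \<forall>t\<in>{ts ! i .. ts ! Suc i}. efun G f e t = of_int m * t + c"
      using PL_pieces[OF f e] by blast
    have "bounded (efun G f e ` {ts ! i .. ts ! Suc i})" if i: "Suc i < length ts" for i
    proof -
      obtain m c where mc: "\<forall>t\<in>{ts ! i .. ts ! Suc i}. efun G f e t = of_int (m::int) * t + c"
        using ts(4)[OF i] by blast
      have "compact ((\<lambda>t. of_int m * t + c) ` {ts ! i .. ts ! Suc i})"
        by (intro compact_continuous_image continuous_intros compact_Icc)
      moreover have "efun G f e ` {ts ! i .. ts ! Suc i} = (\<lambda>t. of_int m * t + c) ` {ts ! i .. ts ! Suc i}"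
        using mc by (intro image_cong) auto
      ultimately show ?thesis by (simp add: compact_imp_bounded)
    qed
    then have "bounded (\<Union>i\<in>{i. Suc i < length ts}. efun G f e ` {ts ! i .. ts ! Suc i})"
    proof (intro bounded_UN)
      show "finite {i. Suc i < length ts}" by (rule finite_subset[of _ "{..<length ts}"]) auto
    qed auto
    moreover have "f ` {GE e t | t. 0 < t \<and> t < elen G e}
        \<subseteq> (\<Union>i\<in>{i. Suc i < length ts}. efun G f e ` {ts ! i .. ts ! Suc i})"
    proof
      fix y assume "y \<in> f ` {GE e t | t. 0 < t \<and> t < elen G e}"
      then obtain t where t: "0 < t" "t < elen G e" "y = f (GE e t)" by auto
      then have "y = efun G f e t" by (simp add: efun_def)
      moreover obtain i where "Suc i < length ts" "ts ! i \<le> t" "t < ts ! Suc i"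
        using bracketing_right[of ts t] ts t by auto
      ultimately show "y \<in> (\<Union>i\<in>{i. Suc i < length ts}. efun G f e ` {ts ! i .. ts ! Suc i})"
        by (intro UN_I[of i]) auto
    qed
    ultimately show ?thesis by (rule bounded_subset)
  qed
  have "pts G = GV ` verts G \<union> (\<Union>e\<in>edges G. {GE e t | t. 0 < t \<and> t < elen G e})"
    by (auto simp: pts_def)
  moreover have "bounded (f ` GV ` verts G)"
    using mg by (intro finite_imp_bounded) (simp add: metric_graph_def)
  moreover have "bounded (\<Union>e\<in>edges G. f ` {GE e t | t. 0 < t \<and> t < elen G e})"
    using mg edge by (intro bounded_UN) (auto simp: metric_graph_def)
  ultimately show ?thesis by (simp add: image_Un image_UN)
qed

text \<open>A function affine in the distance from x does not bend at points further out: its two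
  slopes there are opposite. A bend of a combination thus requires two different generators.\<close>

lemma germ_interior:
  assumes "\<And>u. 0 < u \<Longrightarrow> u < \<delta> \<Longrightarrow> f (along G (x, b, e) u) = c + of_int m * u" "0 < s" "s < \<delta>"
  shows "germ G f (along G (x, b, e) s, b, e) m" "germ G f (along G (x, b, e) s, \<not> b, e) (- m)"
proof -
  have ev: "\<forall>\<^sub>F u in at_right 0. 0 < u \<and> u < min s (\<delta> - s)"
    using assms by (intro eventually_at_right_0_less) simp
  have fwd: "along G (along G (x, b, e) s, b, e) u = along G (x, b, e) (s + u)"
    and bwd: "along G (along G (x, b, e) s, \<not> b, e) u = along G (x, b, e) (s - u)" for u
    by (auto simp: along_def tpos_def)
  show "germ G f (along G (x, b, e) s, b, e) m"
    unfolding germ_def fwd using ev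
    by eventually_elim (use assms in \<open>auto simp: algebra_simps\<close>)
  show "germ G f (along G (x, b, e) s, \<not> b, e) (- m)"
    unfolding germ_def bwd using ev
    by eventually_elim (use assms in \<open>auto simp: algebra_simps\<close>)
qed

lemma Att_nonempty:
  assumes "finite F" "F \<noteq> {}"
  shows "Att F a x \<noteq> {}"
proof -
  have "Min ((\<lambda>f. f x + a f) ` F) \<in> (\<lambda>f. f x + a f) ` F" using assms by (intro Min_in) auto
  then obtain f where "f \<in> F" "f x + a f = Min ((\<lambda>f. f x + a f) ` F)" by auto
  then have "f \<in> Att F a x" using assms by (auto simp: Att_def)
  then show ?thesis by blast
qed

lemma tcomb_Att:
  assumes "finite F" "x \<in> pts G" "f \<in> Att F a x"
  shows "tcomb G F a x = f x + a f"
  using assms by (auto simp: tcomb_def Att_def intro!: Min_eqI)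

lemma tcomb_le:
  assumes "finite F" "x \<in> pts G" "f \<in> F"
  shows "tcomb G F a x \<le> f x + a f"
  using assms by (auto simp: tcomb_def intro!: Min_le)

lemma tcomb_eq_iff_Att:
  assumes "finite F" "x \<in> pts G" "f \<in> F"
  shows "f x + a f = tcomb G F a x \<longleftrightarrow> f \<in> Att F a x"
proof
  assume "f x + a f = tcomb G F a x"
  then show "f \<in> Att F a x" using assms tcomb_le by (auto simp: Att_def)
qed (use assms tcomb_Att in metis)

context
  fixes G :: "('v,'e) mgraph"
  assumes mg: "metric_graph G"
begin

text \<open>Reading functions through \<open>efun\<close> and \<open>tpos\<close> lets vertices and
  interior points be treated alike from here on.\<close>

lemma tangE:
  assumes "x \<in> pts G" "\<eta> \<in> tang G x"
  obtains b e where "\<eta> = (x, b, e)" "e \<in> edges G" "b \<Longrightarrow> 0 \<le> tpos G \<eta> \<and> tpos G \<eta> < elen G e"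
    "\<not> b \<Longrightarrow> 0 < tpos G \<eta> \<and> tpos G \<eta> \<le> elen G e" "\<And>f. efun G f e (tpos G \<eta>) = f x"
proof -
  have pos: "\<And>e. e \<in> edges G \<Longrightarrow> 0 < elen G e" using mg by (auto simp: metric_graph_def)
  show ?thesis
  proof (cases x)
    case (GV v)
    consider e where "\<eta> = (x, True, e)" "e \<in> edges G" "etl G e = v"
      | e where "\<eta> = (x, False, e)" "e \<in> edges G" "ehd G e = v"
      using assms(2) GV by (auto simp: tang_def)
    then show ?thesis
    proof cases
      case (1 e)
      show ?thesis
        by (rule that[OF 1(1,2)]) (use 1 GV pos[OF 1(2)] in \<open>auto simp: tpos_def efun_def\<close>)
    next
      case (2 e)
      show ?thesis
        by (rule that[OF 2(1,2)]) (use 2 GV pos[OF 2(2)] in \<open>auto simp: tpos_def efun_def\<close>)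
    qed
  next
    case (GE e t)
    obtain b where b: "\<eta> = (x, b, e)" using assms(2) GE by (auto simp: tang_def)
    have e: "e \<in> edges G" "0 < t" "t < elen G e" using assms(1) GE by (auto simp: pts_def)
    show ?thesis
      by (rule that[OF b e(1)]) (use b e GE in \<open>auto simp: tpos_def efun_def\<close>)
  qed
qed

lemma fst_tang: "x \<in> pts G \<Longrightarrow> \<eta> \<in> tang G x \<Longrightarrow> fst \<eta> = x"
  by (metis tangE fst_conv)

lemma eventually_along_interior:
  assumes "x \<in> pts G" "\<eta> \<in> tang G x"
  shows "\<forall>\<^sub>F s in at_right 0. \<exists>t. along G \<eta> s = GE (snd (snd \<eta>)) t \<and> 0 < t \<and> t < elen G (snd (snd \<eta>))
     \<and> t = tpos G \<eta> + (if fst (snd \<eta>) then s else - s)"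
proof -
  obtain b e where be: "\<eta> = (x, b, e)" "e \<in> edges G" "b \<Longrightarrow> 0 \<le> tpos G \<eta> \<and> tpos G \<eta> < elen G e"
    "\<not> b \<Longrightarrow> 0 < tpos G \<eta> \<and> tpos G \<eta> \<le> elen G e"
    using tangE[OF assms] by metis
  have "\<forall>\<^sub>F s in at_right 0. 0 < s \<and> s < (if b then elen G e - tpos G \<eta> else tpos G \<eta>)"
    using be by (intro eventually_at_right_0_less) auto
  then show ?thesis
    by eventually_elim (use be in \<open>auto simp: along_def split: if_splits\<close>)
qed

lemma eventually_along_pts:
  assumes "x \<in> pts G" "\<eta> \<in> tang G x"
  shows "\<forall>\<^sub>F s in at_right 0. along G \<eta> s \<in> pts G"
proof -
  have "snd (snd \<eta>) \<in> edges G" using tangE[OF assms] by (metis snd_conv)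
  then show ?thesis
    using eventually_along_interior[OF assms] by (auto elim!: eventually_mono simp: pts_def)
qed

lemma germ_ex:
  assumes "x \<in> pts G" "\<eta> \<in> tang G x" "is_PL G f"
  shows "\<exists>m. germ G f \<eta> m"
proof -
  obtain b e where be: "\<eta> = (x, b, e)" "e \<in> edges G" "b \<Longrightarrow> 0 \<le> tpos G \<eta> \<and> tpos G \<eta> < elen G e"
    "\<not> b \<Longrightarrow> 0 < tpos G \<eta> \<and> tpos G \<eta> \<le> elen G e" "\<And>f. efun G f e (tpos G \<eta>) = f x"
    using tangE[OF assms(1,2)] by metis
  have "\<exists>m::int. \<forall>\<^sub>F s in at_right 0. efun G f e (tpos G \<eta> + (if b then s else - s)) = f x + of_int m * s"
    using PL_affine_right[OF assms(3) be(2), of "tpos G \<eta>"]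
      PL_affine_left[OF assms(3) be(2), of "tpos G \<eta>"] be(3-5) by (cases b) auto
  then obtain m :: int where
    "\<forall>\<^sub>F s in at_right 0. efun G f e (tpos G \<eta> + (if b then s else - s)) = f x + of_int m * s" by blast
  then have "\<forall>\<^sub>F s in at_right 0. f (along G \<eta> s) = f (fst \<eta>) + of_int m * s"
    using eventually_along_interior[OF assms(1,2)]
    by eventually_elim (auto simp: be(1) efun_def)
  then show ?thesis by (auto simp: germ_def)
qed

lemma germ_slope:
  assumes "x \<in> pts G" "\<eta> \<in> tang G x" "germ G f \<eta> m"
  shows "slope G f \<eta> = of_int m" "islope G f \<eta> = m"
proof -
  obtain b e where be: "\<eta> = (x, b, e)" "\<And>f. efun G f e (tpos G \<eta>) = f x"
    using tangE[OF assms(1,2)] by metis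
  have "\<forall>\<^sub>F s in at_right 0.
    (efun G f e (tpos G \<eta> + (if b then s else - s)) - efun G f e (tpos G \<eta>)) / s = of_int m"
    using eventually_along_interior[OF assms(1,2)] assms(3)[unfolded germ_def]
      eventually_at_right_less[of 0]
  proof eventually_elim
    case (elim s)
    have "efun G f e (tpos G \<eta> + (if b then s else - s)) = f (along G \<eta> s)"
      using elim(1) by (auto simp: be(1) efun_def)
    then show ?case using elim(2,3) be by simp
  qed
  then have "((\<lambda>s. (efun G f e (tpos G \<eta> + (if b then s else - s)) - efun G f e (tpos G \<eta>)) / s)
     \<longlongrightarrow> of_int m) (at_right 0)"
    by (rule tendsto_eventually)
  then show "slope G f \<eta> = of_int m"
    using tendsto_Lim[OF trivial_limit_at_right_real] by (simp add: slope_def be(1))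
  then show "islope G f \<eta> = m" by (simp add: islope_def)
qed

lemma germ_islope:
  assumes "x \<in> pts G" "\<eta> \<in> tang G x" "is_PL G f"
  shows "germ G f \<eta> (islope G f \<eta>)" "slope G f \<eta> = of_int (islope G f \<eta>)"
  using germ_ex[OF assms] germ_slope[OF assms(1,2)] by auto

lemma along_eventually_affine:
  assumes "x \<in> pts G" "\<eta> \<in> tang G x" "is_PL G f"
  shows "\<forall>\<^sub>F s in at_right 0. f (along G \<eta> s) = f x + of_int (islope G f \<eta>) * s"
  using germ_islope(1)[OF assms] fst_tang[OF assms(1,2)] by (simp add: germ_def)

lemma along_tendsto:
  assumes "x \<in> pts G" "\<eta> \<in> tang G x" "is_PL G f"
  shows "((\<lambda>s. f (along G \<eta> s)) \<longlongrightarrow> f x) (at_right 0)"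
proof -
  have "((\<lambda>s. f x + of_int (islope G f \<eta>) * s) \<longlongrightarrow> f x + of_int (islope G f \<eta>) * 0) (at_right 0)"
    by (intro tendsto_intros)
  then show ?thesis
    using along_eventually_affine[OF assms] by (simp add: filterlim_cong)
qed

section \<open>Tropical linear combinations\<close>

text \<open>Generators not attaining the minimum at x stay above it nearby by continuity. Those
  attaining it start from the same value, so the least slope wins.\<close>

lemma germ_tcomb:
  assumes F: "finite F" "\<And>f. f \<in> F \<Longrightarrow> is_PL G f"
    and x: "x \<in> pts G" "\<eta> \<in> tang G x"
    and f0: "f0 \<in> Att F a x" "\<And>g. g \<in> Att F a x \<Longrightarrow> islope G f0 \<eta> \<le> islope G g \<eta>"
  shows "germ G (tcomb G F a) \<eta> (islope G f0 \<eta>)"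
proof -
  let ?m = "\<lambda>f. islope G f \<eta>"
  have f0F: "f0 \<in> F" using f0 by (simp add: Att_def)
  have "\<forall>\<^sub>F s in at_right 0. f0 x + a f0 + of_int (?m f0) * s \<le> f x + a f + of_int (?m f) * s"
    if f: "f \<in> F" for f
  proof (cases "f \<in> Att F a x")
    case True
    then have "f x + a f = f0 x + a f0" using f0(1) tcomb_Att[OF F(1) x(1)] by metis
    then show ?thesis
      using eventually_at_right_less[of 0] f0(2)[OF True]
      by (auto elim!: eventually_mono intro: mult_right_mono)
  next
    case False
    then obtain g where "g \<in> F" "g x + a g < f x + a f" using f by (auto simp: Att_def)
    moreover have "f0 x + a f0 \<le> g x + a g" using f0(1) \<open>g \<in> F\<close> by (auto simp: Att_def)
    ultimately have gap: "f0 x + a f0 < f x + a f" by simp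
    have "((\<lambda>s. f0 x + a f0 + of_int (?m f0) * s) \<longlongrightarrow> f0 x + a f0 + of_int (?m f0) * 0) (at_right 0)"
      "((\<lambda>s. f x + a f + of_int (?m f) * s) \<longlongrightarrow> f x + a f + of_int (?m f) * 0) (at_right 0)"
      by (intro tendsto_intros)+
    from order_tendstoD(2)[OF tendsto_diff[OF this], of 0] gap
    show ?thesis by (auto elim!: eventually_mono)
  qed
  then have "\<forall>\<^sub>F s in at_right 0. \<forall>f\<in>F. f0 x + a f0 + of_int (?m f0) * s \<le> f x + a f + of_int (?m f) * s"
    using F(1) by (simp add: eventually_ball_finite_distrib)
  moreover have "\<forall>\<^sub>F s in at_right 0. \<forall>f\<in>F. f (along G \<eta> s) = f x + of_int (?m f) * s"
    using F along_eventually_affine[OF x] by (simp add: eventually_ball_finite_distrib)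
  moreover note eventually_along_pts[OF x]
  ultimately have "\<forall>\<^sub>F s in at_right 0. tcomb G F a (along G \<eta> s) = f0 x + a f0 + of_int (?m f0) * s"
  proof eventually_elim
    case (elim s)
    then have "f0 \<in> Att F a (along G \<eta> s)" using f0F by (auto simp: Att_def algebra_simps)
    then show ?case using tcomb_Att[OF F(1) elim(3)] elim(2) f0F by simp
  qed
  then show ?thesis using fst_tang[OF x] tcomb_Att[OF F(1) x(1) f0(1)] by (simp add: germ_def)
qed

lemma islope_tcomb:
  assumes F: "finite F" "F \<noteq> {}" "\<And>f. f \<in> F \<Longrightarrow> is_PL G f"
    and x: "x \<in> pts G" "\<eta> \<in> tang G x"
  shows "\<exists>f\<in>Att F a x. islope G (tcomb G F a) \<eta> = islope G f \<eta>"
    and "\<And>g. g \<in> Att F a x \<Longrightarrow> islope G (tcomb G F a) \<eta> \<le> islope G g \<eta>"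
proof -
  have fin: "finite (Att F a x)" using F(1) by (simp add: Att_def)
  then have "Min ((\<lambda>f. islope G f \<eta>) ` Att F a x) \<in> (\<lambda>f. islope G f \<eta>) ` Att F a x"
    using Att_nonempty[OF F(1,2)] by (intro Min_in) auto
  then obtain f0 where f0: "f0 \<in> Att F a x" "islope G f0 \<eta> = Min ((\<lambda>f. islope G f \<eta>) ` Att F a x)"
    by auto
  then have f0_min: "\<And>g. g \<in> Att F a x \<Longrightarrow> islope G f0 \<eta> \<le> islope G g \<eta>"
    using fin by auto
  have "islope G (tcomb G F a) \<eta> = islope G f0 \<eta>"
    using germ_slope(2)[OF x germ_tcomb[OF F(1,3) x f0(1) f0_min]] by simp
  then show "\<exists>f\<in>Att F a x. islope G (tcomb G F a) \<eta> = islope G f \<eta>"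
    "\<And>g. g \<in> Att F a x \<Longrightarrow> islope G (tcomb G F a) \<eta> \<le> islope G g \<eta>"
    using f0(1) f0_min by (auto intro!: bexI[of _ f0])
qed

lemma slope_tcomb_eq_islope:
  assumes F: "finite F" "F \<noteq> {}" "\<And>f. f \<in> F \<Longrightarrow> is_PL G f"
    and x: "x \<in> pts G" "\<eta> \<in> tang G x"
  shows "slope G (tcomb G F a) \<eta> = of_int (islope G (tcomb G F a) \<eta>)"
proof -
  obtain f where f: "f \<in> Att F a x" "islope G (tcomb G F a) \<eta> = islope G f \<eta>"
    using islope_tcomb(1)[OF F x] by blast
  then have "germ G (tcomb G F a) \<eta> (islope G f \<eta>)"
    using islope_tcomb(2)[OF F x, of _ a] by (intro germ_tcomb[OF F(1,3) x]) auto
  then show ?thesis using germ_slope[OF x] by simp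
qed

lemma generators_in_span:
  assumes F: "finite F" "\<And>f. f \<in> F \<Longrightarrow> is_PL G f" and f: "f \<in> F"
  shows "f \<in> tspan G F"
proof -
  have "bounded (\<Union>g\<in>F. g ` pts G)" using F PL_bounded[OF mg] by (intro bounded_UN) auto
  then obtain C where C: "\<And>g x. g \<in> F \<Longrightarrow> x \<in> pts G \<Longrightarrow> \<bar>g x\<bar> \<le> C"
    by (fastforce simp: bounded_iff)
  \<comment> \<open>Coefficients are finite, so the other generators cannot be omitted; they are
    lifted out of the way. With all values in \<open>[-C, C]\<close>, a lift by \<open>2 * C\<close>
    is enough.\<close>
  let ?a = "\<lambda>g. if g = f then 0 else 2 * C"
  have "tcomb G F ?a x = f x" for x
  proof (cases "x \<in> pts G")
    case True
    have "f x + ?a f \<le> g x + ?a g" if "g \<in> F" for g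
      using C[OF that True] C[OF f True] by auto
    then have "f \<in> Att F ?a x" using f by (simp add: Att_def)
    then show ?thesis using tcomb_Att[OF F(1) True] by fastforce
  next
    case False
    then show ?thesis using F(2)[OF f] by (simp add: tcomb_def is_PL_def)
  qed
  then have "f = tcomb G F ?a" by auto
  then show ?thesis by (auto simp: tspan_def)
qed

text \<open>The coefficient \<open>b f\<close> is the least one with \<open>g \<le> f + b f\<close>
  on the graph, so the combination with coefficients b is the smallest element of the span above g.
  An element of the span within \<open>\<epsilon> / 2\<close> of g has coefficients at least
  \<open>b f - \<epsilon> / 2\<close>, so this smallest element exceeds g by at most
  \<epsilon>.\<close>

lemma tspan_sup_closed:
  assumes F: "finite F" "F \<noteq> {}" "\<And>f. f \<in> F \<Longrightarrow> is_PL G f"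
    and fs: "\<And>n. fs n \<in> tspan G F" and g: "is_PL G g"
    and lim: "uniform_limit (pts G) fs g sequentially"
  shows "g \<in> tspan G F"
proof -
  define b where "b = (\<lambda>f. SUP x\<in>pts G. g x - f x)"
  have bdd: "bdd_above ((\<lambda>x. g x - f x) ` pts G)" if f: "f \<in> F" for f
  proof -
    have "bounded ((\<lambda>x. g x - f x) ` pts G)"
      using PL_bounded[OF mg g] PL_bounded[OF mg F(3)[OF f]] by (rule bounded_minus_comp)
    then show ?thesis by (rule bounded_imp_bdd_above)
  qed
  have ne: "pts G \<noteq> {}" using mg by (auto simp: metric_graph_def pts_def)
  have "g x = tcomb G F b x" for x
  proof (cases "x \<in> pts G")
    case True
    obtain h where h: "h \<in> Att F b x" using Att_nonempty[OF F(1,2)] by blast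
    then have hF: "h \<in> F" by (simp add: Att_def)
    have "g x - h x \<le> b h" unfolding b_def by (rule cSUP_upper[OF True bdd[OF hF]])
    moreover have "h x + b h \<le> g x + \<epsilon>" if "0 < \<epsilon>" for \<epsilon>
    proof -
      have "\<forall>\<^sub>F n in sequentially. \<forall>y\<in>pts G. dist (fs n y) (g y) < \<epsilon> / 2"
        using lim half_gt_zero[OF that] unfolding uniform_limit_iff by blast
      then obtain n where n: "\<And>y. y \<in> pts G \<Longrightarrow> dist (fs n y) (g y) < \<epsilon> / 2"
        by (auto simp: eventually_sequentially)
      obtain a where a: "fs n = tcomb G F a" using fs[of n] by (auto simp: tspan_def)
      obtain f where f: "f \<in> Att F a x" using Att_nonempty[OF F(1,2)] by blast
      then have fF: "f \<in> F" by (simp add: Att_def)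
      have "b f \<le> a f + \<epsilon> / 2"
        unfolding b_def
      proof (rule cSUP_least[OF ne])
        fix y assume y: "y \<in> pts G"
        show "g y - f y \<le> a f + \<epsilon> / 2"
          using tcomb_le[OF F(1) y fF, of a] n[OF y] unfolding a dist_real_def by linarith
      qed
      moreover have "f x + a f \<le> g x + \<epsilon> / 2"
        using tcomb_Att[OF F(1) True f] n[OF True] unfolding a dist_real_def by linarith
      moreover have "h x + b h \<le> f x + b f" using h fF by (auto simp: Att_def)
      ultimately show ?thesis by simp
    qed
    then have "h x + b h \<le> g x" by (rule field_le_epsilon)
    ultimately show ?thesis using tcomb_Att[OF F(1) True h] by simp
  next
    case False
    then show ?thesis using g by (simp add: tcomb_def is_PL_def)
  qed
  then have "g = tcomb G F b" by auto
  then show ?thesis by (auto simp: tspan_def)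
qed

end

section \<open>Slope counts for tropical linear series\<close>

text \<open>The trace that tropical dependence leaves at x, with \<open>M\<close> in the role of the
  functions attaining the minimum there. As \<open>M\<close> may be a proper subset, functions
  outside it can be discarded from \<open>S\<close>.\<close>

definition locdep :: "('v,'e) mgraph \<Rightarrow> ('v,'e) gpt \<Rightarrow> (('v,'e) gpt \<Rightarrow> real) set \<Rightarrow> bool" where
  "locdep G x S \<longleftrightarrow> (\<exists>M\<subseteq>S. M \<noteq> {} \<and> (\<forall>\<eta>\<in>tang G x. \<exists>f\<in>M. \<exists>g\<in>M. f \<noteq> g \<and>
     islope G f \<eta> = islope G g \<eta> \<and> (\<forall>h\<in>M. islope G f \<eta> \<le> islope G h \<eta>)))"

lemma finite_frequently_witness:
  assumes "finite A" "F \<noteq> bot" "\<forall>\<^sub>F s in F. \<exists>p\<in>A. P p s"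
  shows "\<exists>p\<in>A. \<exists>\<^sub>F s in F. P p s"
proof (rule ccontr)
  assume "\<not> (\<exists>p\<in>A. \<exists>\<^sub>F s in F. P p s)"
  then have "\<forall>\<^sub>F s in F. \<forall>p\<in>A. \<not> P p s"
    using assms(1) by (simp add: eventually_ball_finite_distrib frequently_def)
  with assms(3) have "\<forall>\<^sub>F s in F. False" by eventually_elim auto
  then show False using assms(2) by (simp add: trivial_limit_def)
qed

lemma card_image_le_if_no_injective_subset:
  assumes "finite (h ` A)" "\<And>S. S \<subseteq> A \<Longrightarrow> finite S \<Longrightarrow> card S = Suc n \<Longrightarrow> \<not> inj_on h S"
  shows "card (h ` A) \<le> n"
proof (rule ccontr)
  assume "\<not> card (h ` A) \<le> n"
  then have "Suc n \<le> card (h ` A)" by simp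
  then obtain T where T: "T \<subseteq> h ` A" "card T = Suc n" "finite T"
    using obtain_subset_with_card_n by metis
  then obtain S where S: "S \<subseteq> A" "inj_on h S" "T = h ` S" by (auto simp: subset_image_inj)
  have "finite S" using T(3) S by (simp add: finite_image_iff)
  moreover have "card S = Suc n" using T(2) S by (simp add: card_image)
  ultimately show False using assms(2) S by blast
qed

lemma locdep_not_inj:
  assumes "locdep G x S" "\<eta> \<in> tang G x"
  shows "\<not> inj_on (\<lambda>f. islope G f \<eta>) S"
  using assms unfolding locdep_def inj_on_def by blast

lemma SR_imp_TLS: "SR G D r \<Sigma> \<Longrightarrow> TLS G D \<Sigma> r"
  by (cases r) auto

lemma eventually_along_avoids:
  assumes "finite B"
  shows "\<forall>\<^sub>F s in at_right 0. along G \<eta> s \<notin> B"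
proof -
  have "\<forall>\<^sub>F s in at_right 0. along G \<eta> s \<noteq> p" for p
  proof (cases "\<exists>s>0. along G \<eta> s = p")
    case True
    then obtain s0 where "0 < s0" "along G \<eta> s0 = p" by blast
    then show ?thesis
      using eventually_at_right_0_less[of s0]
      by (auto elim!: eventually_mono simp: along_def split: prod.splits if_splits)
  next
    case False
    then show ?thesis by (auto intro: eventually_mono[OF eventually_at_right_less[of 0]])
  qed
  then have "\<forall>\<^sub>F s in at_right 0. \<forall>p\<in>B. along G \<eta> s \<noteq> p"
    using assms by (simp add: eventually_ball_finite_distrib)
  then show ?thesis by (auto elim!: eventually_mono)
qed

text \<open>Concavity of a minimum of affine functions: moving away from x, the slopes of the
  attaining functions do not increase.\<close>

lemma Att_slope_antimono:
  assumes "f \<in> Att F a (along G \<eta> s)" "g \<in> Att F a (along G \<eta> s')" "s < s'"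
    and "f (along G \<eta> s) = f x + of_int m * s" "f (along G \<eta> s') = f x + of_int m * s'"
    and "g (along G \<eta> s) = g x + of_int k * s" "g (along G \<eta> s') = g x + of_int k * s'"
  shows "k \<le> m"
proof -
  have "f x + of_int m * s + a f \<le> g x + of_int k * s + a g"
    "g x + of_int k * s' + a g \<le> f x + of_int m * s' + a f"
    using assms by (auto simp: Att_def)
  then have "of_int k * (s' - s) \<le> of_int m * (s' - s)" by (simp add: algebra_simps)
  then have "real_of_int k \<le> of_int m" using assms(3) by (simp add: mult_le_cancel_right)
  then show ?thesis by simp
qed

context
  fixes G :: "('v,'e) mgraph"
  assumes mg: "metric_graph G"
begin

lemma finite_tang: "finite (tang G x)"
proof (cases x)
  case (GV v)
  have "tang G x \<subseteq> {x} \<times> UNIV \<times> edges G" using GV by (auto simp: tang_def)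
  moreover have "finite ({x} \<times> (UNIV :: bool set) \<times> edges G)" using mg by (simp add: metric_graph_def)
  ultimately show ?thesis by (rule finite_subset)
qed (simp add: tang_def)

text \<open>There is at least one edge. A path from the vertex to its tail either is trivial or
  begins with an edge at the vertex.\<close>

lemma tang_nonempty:
  assumes "x \<in> pts G"
  shows "tang G x \<noteq> {}"
proof (cases x)
  case (GV v)
  have v: "v \<in> verts G" using assms GV by (auto simp: pts_def)
  obtain e where e: "e \<in> edges G" "etl G e \<in> verts G" using mg by (auto simp: metric_graph_def)
  let ?R = "{(etl G e, ehd G e) | e. e \<in> edges G} \<union> {(ehd G e, etl G e) | e. e \<in> edges G}"
  have "(v, etl G e) \<in> ?R\<^sup>*" using mg v e by (simp add: metric_graph_def)
  then have "v = etl G e \<or> (\<exists>w. (v, w) \<in> ?R)" by (meson converse_rtranclE)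
  then show ?thesis using e(1) GV by (auto simp: tang_def)
qed (simp add: tang_def)

text \<open>The two functions attaining the minimum may vary with the point along \<eta>, but there
  are finitely many pairs, so one pair recurs arbitrarily close to x. Comparing affine germs, both
  members attain the minimum at x and have the least slope along \<eta>.\<close>

lemma trop_dep_locdep:
  assumes S: "finite S" "\<And>f. f \<in> S \<Longrightarrow> is_PL G f" and dep: "trop_dep G S" and x: "x \<in> pts G"
  shows "locdep G x S"
proof -
  obtain a where a: "\<And>y. y \<in> pts G \<Longrightarrow> \<exists>f\<in>S. \<exists>g\<in>S. f \<noteq> g \<and>
      f y + a f = tcomb G S a y \<and> g y + a g = tcomb G S a y"
    using dep unfolding trop_dep_def by (auto simp: tcomb_def)
  have ne: "S \<noteq> {}" using a[OF x] by auto
  have "\<exists>f\<in>Att S a x. \<exists>g\<in>Att S a x. f \<noteq> g \<and> islope G f \<eta> = islope G g \<eta>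
     \<and> (\<forall>h\<in>Att S a x. islope G f \<eta> \<le> islope G h \<eta>)" if \<eta>: "\<eta> \<in> tang G x" for \<eta>
  proof -
    note isl = islope_tcomb[OF mg S(1) ne S(2) x \<eta>, where a = a]
    let ?T = "tcomb G S a"
    let ?m = "islope G ?T \<eta>"
    obtain f0 where f0: "f0 \<in> Att S a x" "?m = islope G f0 \<eta>" using isl(1) by blast
    have "germ G ?T \<eta> ?m"
      unfolding f0(2) using isl(2) f0 by (intro germ_tcomb[OF mg S x \<eta> f0(1)]) auto
    then have T: "\<forall>\<^sub>F s in at_right 0. ?T (along G \<eta> s) = ?T x + of_int ?m * s"
      using fst_tang[OF mg x \<eta>] by (simp add: germ_def)
    have fs: "\<forall>\<^sub>F s in at_right 0. \<forall>f\<in>S. f (along G \<eta> s) = f x + of_int (islope G f \<eta>) * s"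
      using S along_eventually_affine[OF mg x \<eta>] by (simp add: eventually_ball_finite_distrib)
    let ?P = "\<lambda>f s. (f x + a f) + of_int (islope G f \<eta>) * s = ?T x + of_int ?m * s"
    let ?Q = "\<lambda>p s. fst p \<noteq> snd p \<and> ?P (fst p) s \<and> ?P (snd p) s"
    have "\<forall>\<^sub>F s in at_right 0. \<exists>p\<in>S \<times> S. ?Q p s"
      using T fs eventually_along_pts[OF mg x \<eta>]
    proof eventually_elim
      case (elim s)
      obtain f g where fg: "f \<in> S" "g \<in> S" "f \<noteq> g" "f (along G \<eta> s) + a f = ?T (along G \<eta> s)"
        "g (along G \<eta> s) + a g = ?T (along G \<eta> s)"
        using a[OF elim(3)] by blast
      then have "?P f s" "?P g s" using elim(1,2) by (auto simp: algebra_simps)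
      then show ?case using fg by (intro bexI[of _ "(f, g)"]) auto
    qed
    then obtain p where p: "p \<in> S \<times> S" "\<exists>\<^sub>F s in at_right 0. ?Q p s"
      using finite_frequently_witness[OF finite_cartesian_product[OF S(1) S(1)] trivial_limit_at_right_real,
          where P = ?Q] by blast
    obtain f g where fg: "p = (f, g)" by (cases p)
    have ne: "f \<noteq> g" using p(2) by (auto simp: fg frequently_def)
    have "\<exists>\<^sub>F s in at_right 0. ?P f s" "\<exists>\<^sub>F s in at_right 0. ?P g s"
      using p(2) by (auto simp: fg elim!: frequently_elim1)
    note eqs = frequently_affine_eq[OF this(1)] frequently_affine_eq[OF this(2)]
    have "f \<in> S" "g \<in> S" using p(1) by (auto simp: fg)
    then have "f \<in> Att S a x" "g \<in> Att S a x"
      using eqs tcomb_eq_iff_Att[OF S(1) x] by auto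
    moreover have "islope G f \<eta> = ?m" "islope G g \<eta> = ?m" using eqs by auto
    ultimately show ?thesis using isl(2) ne by (intro bexI[of _ f] bexI[of _ g]) auto
  qed
  then show ?thesis
    unfolding locdep_def using Att_nonempty[OF S(1) ne]
    by (intro exI[of _ "Att S a x"]) (auto simp: Att_def)
qed

text \<open>Condition (1) is applied to a divisor obtained from \<open>E\<close> by spreading the \<open>E x\<close> chips at \<open>x\<close>
  over distinct points close to \<open>x\<close> on the edge in direction \<open>\<eta> x\<close>: the function breaks at each of them.\<close>

lemma TLS_dispersed:
  assumes tls: "TLS G D \<Sigma> r" and D: "is_divisor G D"
    and F: "finite F" "F \<noteq> {}" "\<And>f. f \<in> F \<Longrightarrow> is_PL G f" "\<Sigma> = tspan G F"
    and E: "effective G E" "deg E = int r"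
    and X: "finite X" "{x. E x \<noteq> 0} \<subseteq> X" "X \<subseteq> pts G"
    and \<eta>: "\<And>x. x \<in> X \<Longrightarrow> \<eta> x \<in> tang G x" and \<delta>: "0 < \<delta>"
  shows "\<exists>a. \<forall>x\<in>X. \<exists>L::int set. finite L \<and> card L = nat (E x) \<and>
     (\<forall>l\<in>L. l < islope G (tcomb G F a) (\<eta> x)) \<and>
     L \<subseteq> (\<lambda>f. islope G f (\<eta> x)) ` (\<Union>s\<in>{0<..<\<delta>}. Att F a (along G (\<eta> x) s))"
proof -
  define m where "m = (\<lambda>x f. islope G f (\<eta> x))"
  have finD: "finite {y. D y \<noteq> 0}" using D by (simp add: is_divisor_def)
  have "\<forall>\<^sub>F s in at_right 0. \<forall>x\<in>X. along G (\<eta> x) s \<in> pts G \<and> along G (\<eta> x) s \<notin> {y. D y \<noteq> 0} \<and>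
      (\<forall>f\<in>F. f (along G (\<eta> x) s) = f x + of_int (m x f) * s)"
  proof -
    have "\<forall>\<^sub>F s in at_right 0. along G (\<eta> x) s \<in> pts G \<and> along G (\<eta> x) s \<notin> {y. D y \<noteq> 0} \<and>
      (\<forall>f\<in>F. f (along G (\<eta> x) s) = f x + of_int (m x f) * s)" if x: "x \<in> X" for x
    proof -
      have xp: "x \<in> pts G" using x X by auto
      have "\<forall>\<^sub>F s in at_right 0. \<forall>f\<in>F. f (along G (\<eta> x) s) = f x + of_int (m x f) * s"
        using F along_eventually_affine[OF mg xp \<eta>[OF x]]
        by (simp add: eventually_ball_finite_distrib m_def)
      then show ?thesis
        using eventually_along_pts[OF mg xp \<eta>[OF x]] eventually_along_avoids[OF finD, of G "\<eta> x"]
        by eventually_elim auto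
    qed
    then show ?thesis using X(1) by (simp add: eventually_ball_finite_distrib)
  qed
  then obtain \<delta>0 where \<delta>0: "0 < \<delta>0" "\<And>s x. 0 < s \<Longrightarrow> s < \<delta>0 \<Longrightarrow> x \<in> X \<Longrightarrow>
      along G (\<eta> x) s \<in> pts G \<and> D (along G (\<eta> x) s) = 0 \<and>
      (\<forall>f\<in>F. f (along G (\<eta> x) s) = f x + of_int (m x f) * s)"
    unfolding eventually_at_right_field by auto
  \<comment> \<open>Up to distance \<open>\<delta>'\<close> the generators are affine in the chosen
    directions and \<open>D\<close> vanishes, so a chip there must come from a bend of the
    function.\<close>
  define \<delta>' where "\<delta>' = min \<delta> \<delta>0"
  have \<delta>': "0 < \<delta>'" using \<delta> \<delta>0 by (simp add: \<delta>'_def)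
  have near: "along G (\<eta> x) s \<in> pts G" "D (along G (\<eta> x) s) = 0"
    "\<And>f. f \<in> F \<Longrightarrow> f (along G (\<eta> x) s) = f x + of_int (m x f) * s"
    if "0 < s" "s < \<delta>'" "x \<in> X" for x s
    using \<delta>0(2)[of s x] that by (auto simp: \<delta>'_def)
  \<comment> \<open>The positions decrease towards x as j grows; the summand 2 keeps even
    \<open>t 0\<close> strictly below \<open>\<delta>'\<close>.\<close>
  define t where "t = (\<lambda>j::nat. \<delta>' / (real j + 2))"
  have t: "0 < t j" "t j < \<delta>'" for j using \<delta>' by (auto simp: t_def field_simps intro!: add_pos_nonneg)
  have t_anti: "t j' < t j" if "j < j'" for j j'
    using \<delta>' that by (auto simp: t_def intro!: divide_strict_left_mono)
  define k where "k = (\<lambda>x. nat (E x))"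
  \<comment> \<open>Chips are indexed by pairs and \<open>E'\<close> counts preimages under q. Chips
    of different points x that land on the same place simply add up, and the degree remains
    r.\<close>
  define J where "J = Sigma X (\<lambda>x. {..<k x})"
  define q where "q = (\<lambda>(x, j). along G (\<eta> x) (t j))"
  define E' where "E' = (\<lambda>y. int (card {i\<in>J. q i = y}))"
  have finJ: "finite J" using X(1) by (simp add: J_def)
  have supp: "{y. E' y \<noteq> 0} = q ` J" using finJ by (auto simp: E'_def card_eq_0_iff)
  have "int (card J) = (\<Sum>y\<in>q ` J. E' y)"
    using sum.image_gen[OF finJ, of "\<lambda>_. 1::nat" q] by (simp add: E'_def)
  then have "deg E' = int (card J)" by (simp add: deg_def supp)
  also have "int (card J) = (\<Sum>x\<in>X. E x)"
  proof -
    have "card J = (\<Sum>x\<in>X. k x)" using X(1) by (simp add: J_def)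
    then show ?thesis using E(1) by (simp add: k_def effective_def)
  qed
  also have "\<dots> = deg E"
    unfolding deg_def using X by (intro sum.mono_neutral_right) auto
  finally have degE': "deg E' = int r" using E(2) by simp
  have "q ` J \<subseteq> pts G" using near(1) t by (auto simp: J_def q_def)
  then have "effective G E'" 
    unfolding effective_def is_divisor_def supp using finJ by (simp add: E'_def)
  then obtain f' where f': "f' \<in> \<Sigma>" "bnrp G D f' E'" using tls degE' by (auto simp: TLS_def)
  then obtain a where a: "f' = tcomb G F a" using F(4) by (auto simp: tspan_def)
  \<comment> \<open>At a dispersed point the two slopes of \<open>f'\<close> add up to at most -1.
    The slope away from x comes from an attaining \<open>f1\<close>, the slope back to x from an
    attaining \<open>f2\<close>; each has opposite slopes in the two directions.\<close>
  have break: "\<exists>f1\<in>Att F a (along G (\<eta> x) (t j)). \<exists>f2\<in>Att F a (along G (\<eta> x) (t j)). m x f1 < m x f2"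
    if x: "x \<in> X" and j: "j < k x" for x j
  proof -
    define p where "p = along G (\<eta> x) (t j)"
    have pp: "p \<in> pts G" and Dp: "D p = 0" using near[OF t x] by (auto simp: p_def)
    have xp: "x \<in> pts G" using x X by auto
    obtain b e where be: "\<eta> x = (x, b, e)" using tangE[OF mg xp \<eta>[OF x]] by metis
    have tp: "tang G p = {(p, b, e), (p, \<not> b, e)}"
      by (cases b) (auto simp: p_def be along_def tang_def)
    have tpb: "(p, b, e) \<in> tang G p" "(p, \<not> b, e) \<in> tang G p" by (auto simp: tp)
    have sl: "islope G f (p, b, e) = m x f" "islope G f (p, \<not> b, e) = - m x f" if f: "f \<in> F" for f
    proof -
      have "germ G f (p, b, e) (m x f)" "germ G f (p, \<not> b, e) (- m x f)"
        using germ_interior[of \<delta>' f G x b e "f x" "m x f" "t j"] near(3)[OF _ _ x f] t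
        by (auto simp: p_def be)
      then show "islope G f (p, b, e) = m x f" "islope G f (p, \<not> b, e) = - m x f"
        using germ_slope(2)[OF mg pp tpb(1)] germ_slope(2)[OF mg pp tpb(2)] by auto
    qed
    have "(x, j) \<in> {i\<in>J. q i = p}" using x j by (auto simp: J_def q_def p_def)
    then have "0 < card {i\<in>J. q i = p}" using finJ by (auto simp: card_gt_0_iff)
    then have "1 \<le> real_of_int (E' p)" by (simp add: E'_def)
    also have "\<dots> \<le> ordv G f' p" using f'(2) pp Dp by (auto simp: bnrp_def)
    also have "\<dots> = - (slope G f' (p, b, e) + slope G f' (p, \<not> b, e))"
      by (auto simp: ordv_def tp)
    also have "\<dots> = - of_int (islope G f' (p, b, e) + islope G f' (p, \<not> b, e))"
      using slope_tcomb_eq_islope[OF mg F(1-3) pp tpb(1)] slope_tcomb_eq_islope[OF mg F(1-3) pp tpb(2)]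
      by (simp add: a)
    finally have "1 \<le> - (islope G f' (p, b, e) + islope G f' (p, \<not> b, e))" by linarith
    moreover obtain f1 where "f1 \<in> Att F a p" "islope G f' (p, b, e) = islope G f1 (p, b, e)"
      using islope_tcomb(1)[OF mg F(1-3) pp tpb(1)] a by blast
    moreover obtain f2 where "f2 \<in> Att F a p" "islope G f' (p, \<not> b, e) = islope G f2 (p, \<not> b, e)"
      using islope_tcomb(1)[OF mg F(1-3) pp tpb(2)] a by blast
    ultimately have "m x f1 < m x f2" using sl[of f1] sl[of f2] by (auto simp: Att_def)
    then show ?thesis using \<open>f1 \<in> Att F a p\<close> \<open>f2 \<in> Att F a p\<close> by (auto simp: p_def)
  qed
  have "\<exists>L::int set. finite L \<and> card L = nat (E x) \<and> (\<forall>l\<in>L. l < islope G f' (\<eta> x)) \<and>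
     L \<subseteq> (\<lambda>f. islope G f (\<eta> x)) ` (\<Union>s\<in>{0<..<\<delta>}. Att F a (along G (\<eta> x) s))" if x: "x \<in> X" for x
  proof -
    have xp: "x \<in> pts G" using x X by auto
    obtain f1 f2 where f12: "\<And>j. j < k x \<Longrightarrow> f1 j \<in> Att F a (along G (\<eta> x) (t j))"
      "\<And>j. j < k x \<Longrightarrow> f2 j \<in> Att F a (along G (\<eta> x) (t j))"
      "\<And>j. j < k x \<Longrightarrow> m x (f1 j) < m x (f2 j)"
      using break[OF x] by metis
    have F12: "f1 j \<in> F" "f2 j \<in> F" if "j < k x" for j using f12 that by (auto simp: Att_def)
    \<comment> \<open>Concavity between consecutive bends and the strict drop at each bend together
      make these slopes distinct.\<close>
    have less: "m x (f1 j) < m x (f1 j')" if "j < j'" "j' < k x" for j j'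
    proof -
      have j: "j < k x" using that by simp
      have "m x (f2 j) \<le> m x (f1 j')"
        using near(3)[OF t x] F12[OF j] F12[OF that(2)]
        by (intro Att_slope_antimono[OF f12(1)[OF that(2)] f12(2)[OF j] t_anti[OF that(1)], where x = x]) auto
      then show ?thesis using f12(3)[OF j] by simp
    qed
    have inj: "inj_on (\<lambda>j. m x (f1 j)) {..<k x}"
    proof (rule linorder_inj_onI)
      fix j j' assume "j < j'" "j \<in> {..<k x}" "j' \<in> {..<k x}"
      then show "m x (f1 j) \<noteq> m x (f1 j')" using less[of j j'] by simp
    qed auto
    obtain g where g: "g \<in> Att F a x" "islope G f' (\<eta> x) = m x g"
      using islope_tcomb(1)[OF mg F(1-3) xp \<eta>[OF x]] unfolding a m_def by blast
    \<comment> \<open>\<open>f2 j\<close> attains the minimum further out than g, so its slope is at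
      most that of g at x; \<open>f1 j\<close> lies strictly below that. The slope at x is thus one
      more value besides the \<open>E x\<close> values in the set.\<close>
    have below: "m x (f1 j) < islope G f' (\<eta> x)" if j: "j < k x" for j
    proof -
      have "g \<in> F" using g by (auto simp: Att_def)
      have "g x + a g \<le> f2 j x + a (f2 j)" using g F12[OF j] by (auto simp: Att_def)
      moreover have "f2 j x + of_int (m x (f2 j)) * t j + a (f2 j) \<le> g x + of_int (m x g) * t j + a g"
        using f12(2)[OF j] \<open>g \<in> F\<close> near(3)[OF t x F12(2)[OF j]] near(3)[OF t x \<open>g \<in> F\<close>]
        by (auto simp: Att_def)
      ultimately have "of_int (m x (f2 j)) * t j \<le> of_int (m x g) * t j" by simp
      then have "m x (f2 j) \<le> m x g" using t(1)[of j] by (simp add: mult_le_cancel_right)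
      then show ?thesis using f12(3)[OF j] g(2) by simp
    qed
    have mem: "f1 j \<in> (\<Union>s\<in>{0<..<\<delta>}. Att F a (along G (\<eta> x) s))" if "j < k x" for j
      using f12(1)[OF that] t[of j] by (auto simp: \<delta>'_def intro!: bexI[of _ "t j"])
    show ?thesis
      by (rule exI[of _ "(\<lambda>j. m x (f1 j)) ` {..<k x}"])
        (use inj below mem in \<open>auto simp: card_image k_def m_def\<close>)
  qed
  then show ?thesis unfolding a by blast
qed

lemma TLS_generators:
  assumes "TLS G D \<Sigma> r"
  obtains F where "finite F" "F \<noteq> {}" "\<And>f. f \<in> F \<Longrightarrow> is_PL G f" "\<Sigma> = tspan G F" "F \<subseteq> \<Sigma>"
proof -
  obtain F where F: "finite F" "F \<noteq> {}" "F \<subseteq> PL G" "\<Sigma> = tspan G F"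
    using assms by (auto simp: TLS_def fin_gen_def)
  have PL: "\<And>f. f \<in> F \<Longrightarrow> is_PL G f" using F(3) by (auto simp: PL_def)
  show ?thesis using that[OF F(1,2) PL F(4)] generators_in_span[OF mg F(1) PL] F(4) by blast
qed

lemma islope_span:
  assumes "finite F" "F \<noteq> {}" "\<And>f. f \<in> F \<Longrightarrow> is_PL G f" "x \<in> pts G" "\<eta> \<in> tang G x"
  shows "(\<lambda>f. islope G f \<eta>) ` tspan G F = (\<lambda>f. islope G f \<eta>) ` F"
proof
  show "(\<lambda>f. islope G f \<eta>) ` F \<subseteq> (\<lambda>f. islope G f \<eta>) ` tspan G F"
    using generators_in_span[OF mg assms(1,3)] by blast
  show "(\<lambda>f. islope G f \<eta>) ` tspan G F \<subseteq> (\<lambda>f. islope G f \<eta>) ` F"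
    using islope_tcomb(1)[OF mg assms] unfolding tspan_def Att_def by fastforce
qed

lemma TLS_locdep:
  assumes "TLS G D \<Sigma> r" "S \<subseteq> \<Sigma>" "finite S" "card S = r + 2" "x \<in> pts G"
  shows "locdep G x S"
proof (rule trop_dep_locdep)
  show "trop_dep G S" using assms by (auto simp: TLS_def)
  show "is_PL G f" if "f \<in> S" for f using that assms by (auto simp: TLS_def RD_def)
qed (use assms in auto)

lemma TLS_card_slopes:
  assumes tls: "TLS G D \<Sigma> r" and D: "is_divisor G D" and x: "x \<in> pts G" "\<eta> \<in> tang G x"
  shows "finite ((\<lambda>f. islope G f \<eta>) ` \<Sigma>)" "card ((\<lambda>f. islope G f \<eta>) ` \<Sigma>) = Suc r"
proof -
  obtain F where F: "finite F" "F \<noteq> {}" "\<And>f. f \<in> F \<Longrightarrow> is_PL G f" "\<Sigma> = tspan G F" "F \<subseteq> \<Sigma>"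
    using TLS_generators[OF tls] by blast
  show fin: "finite ((\<lambda>f. islope G f \<eta>) ` \<Sigma>)"
    using islope_span[OF F(1-3) x] F(1,4) by simp
  have "card ((\<lambda>f. islope G f \<eta>) ` \<Sigma>) \<le> Suc r"
    using TLS_locdep[OF tls _ _ _ x(1)] locdep_not_inj[OF _ x(2)]
    by (intro card_image_le_if_no_injective_subset[OF fin]) auto
  moreover have "Suc r \<le> card ((\<lambda>f. islope G f \<eta>) ` \<Sigma>)"
  proof -
    let ?E = "\<lambda>y. if y = x then int r else 0"
    have E: "effective G ?E" "deg ?E = int r"
      using x by (auto simp: effective_def is_divisor_def deg_def split: if_splits)
    have supp: "{y. ?E y \<noteq> 0} \<subseteq> {x}" by auto
    obtain a L where aL: "finite L" "card L = r" "\<And>l. l \<in> L \<Longrightarrow> l < islope G (tcomb G F a) \<eta>"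
      "L \<subseteq> (\<lambda>f. islope G f \<eta>) ` (\<Union>s\<in>{0<..<1}. Att F a (along G \<eta> s))"
      using TLS_dispersed[OF tls D F(1-4) E _ supp, of "\<lambda>_. \<eta>" 1] x by auto
    have "tcomb G F a \<in> \<Sigma>" by (auto simp: F(4) tspan_def)
    moreover have "(\<Union>s\<in>{0<..<1}. Att F a (along G \<eta> s)) \<subseteq> \<Sigma>" using F(5) by (auto simp: Att_def)
    ultimately have "insert (islope G (tcomb G F a) \<eta>) L \<subseteq> (\<lambda>f. islope G f \<eta>) ` \<Sigma>"
      using aL(4) by blast
    moreover have "card (insert (islope G (tcomb G F a) \<eta>) L) = Suc r"
      using aL(1-3) by (subst card_insert_disjoint) auto
    ultimately show ?thesis using fin card_mono by metis
  qed
  ultimately show "card ((\<lambda>f. islope G f \<eta>) ` \<Sigma>) = Suc r" by simp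
qed

end

section \<open>Rankability at a point\<close>

definition slopes_ge :: "('v,'e) mgraph \<Rightarrow> ('v,'e) gpt \<Rightarrow> (('v,'e) gpt \<Rightarrow> real) set
    \<Rightarrow> (('v,'e) tang \<Rightarrow> int) \<Rightarrow> (('v,'e) gpt \<Rightarrow> real) set" where
  "slopes_ge G x \<Sigma> z = {f\<in>\<Sigma>. \<forall>\<eta>\<in>tang G x. z \<eta> \<le> islope G f \<eta>}"

text \<open>The invariant pins the number of slopes of \<open>slopes_ge G x \<Sigma> z\<close> in every tangent direction to
  exactly \<open>n\<close>: the subseries of rank \<open>n - 1\<close> bounds it from below, local dependence from above.\<close>

definition pinned :: "('v,'e) mgraph \<Rightarrow> (('v,'e) gpt \<Rightarrow> int) \<Rightarrow> ('v,'e) gpt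
    \<Rightarrow> (('v,'e) gpt \<Rightarrow> real) set \<Rightarrow> nat \<Rightarrow> bool" where
  "pinned G D x A n \<longleftrightarrow> (0 < n \<longrightarrow> (\<exists>W\<subseteq>A. SR G D (n - 1) W)) \<and>
     (\<forall>S\<subseteq>A. finite S \<longrightarrow> card S = Suc n \<longrightarrow> locdep G x S)"

context
  fixes G :: "('v,'e) mgraph" and D :: "('v,'e) gpt \<Rightarrow> int" and x :: "('v,'e) gpt"
  assumes mg: "metric_graph G" and D: "is_divisor G D" and x: "x \<in> pts G"
begin

lemma pinned_card_slopes:
  assumes "pinned G D x A n" "\<eta> \<in> tang G x" "finite ((\<lambda>f. islope G f \<eta>) ` A)"
  shows "card ((\<lambda>f. islope G f \<eta>) ` A) = n"
proof (rule antisym)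
  show "card ((\<lambda>f. islope G f \<eta>) ` A) \<le> n"
    using assms(1) locdep_not_inj[OF _ assms(2)] unfolding pinned_def
    by (intro card_image_le_if_no_injective_subset[OF assms(3)]) blast
  show "n \<le> card ((\<lambda>f. islope G f \<eta>) ` A)"
  proof (cases "n = 0")
    case False
    then obtain W where W: "W \<subseteq> A" "SR G D (n - 1) W" using assms(1) by (auto simp: pinned_def)
    then have "card ((\<lambda>f. islope G f \<eta>) ` W) = n"
      using TLS_card_slopes(2)[OF mg SR_imp_TLS[OF W(2)] D x assms(2)] False by simp
    then show ?thesis using card_mono[OF assms(3) image_mono[OF W(1)]] by simp
  qed simp
qed

text \<open>\<open>W\<close> has \<open>m + 2\<close> slopes along \<eta>. Choose
  \<open>m + 1\<close> functions realizing all but the least; condition (3) puts them into a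
  subseries of rank m, which has exactly \<open>m + 1\<close> slopes and hence none but
  these.\<close>

lemma SR_raise:
  assumes W: "SR G D (Suc m) W" and \<eta>: "\<eta> \<in> tang G x" and z: "\<And>f. f \<in> W \<Longrightarrow> z \<le> islope G f \<eta>"
  shows "\<exists>W'\<subseteq>W. SR G D m W' \<and> (\<forall>f\<in>W'. z < islope G f \<eta>)"
proof -
  let ?h = "\<lambda>f. islope G f \<eta>"
  note slW = TLS_card_slopes[OF mg SR_imp_TLS[OF W] D x \<eta>]
  have "?h ` W \<noteq> {}" using slW(2) card.empty by (metis nat.distinct(1))
  then have Min_W: "Min (?h ` W) \<in> ?h ` W" using slW(1) by (intro Min_in)
  have "?h ` W - {Min (?h ` W)} \<subseteq> ?h ` W" by blast
  then obtain S where S: "S \<subseteq> W" "inj_on ?h S" "?h ` W - {Min (?h ` W)} = ?h ` S"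
    unfolding subset_image_inj by blast
  have "card (?h ` S) = Suc m"
    unfolding S(3)[symmetric] card_Diff_singleton[OF Min_W] slW(2) by simp
  note S = S(1,2) S(3)[symmetric] this
  have "finite (?h ` S)" using S(3) slW(1) by simp
  then have finS: "finite S" and cardS: "card S = Suc m"
    using S(2,4) by (simp_all add: finite_image_iff card_image)
  have "\<forall>S. S \<subseteq> W \<and> finite S \<and> card S = Suc m \<longrightarrow> (\<exists>W'. S \<subseteq> W' \<and> W' \<subseteq> W \<and> SR G D m W')"
    using W[unfolded SR.simps] by (elim conjE)
  from mp[OF spec[OF this, of S]] S(1) finS cardS
  have "\<exists>W'. S \<subseteq> W' \<and> W' \<subseteq> W \<and> SR G D m W'" by simp
  then obtain W' where W': "S \<subseteq> W'" "W' \<subseteq> W" "SR G D m W'" by (elim exE conjE)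
  note slW' = TLS_card_slopes[OF mg SR_imp_TLS[OF W'(3)] D x \<eta>]
  have "?h ` S \<subseteq> ?h ` W'" using W'(1) by blast
  then have eq: "?h ` S = ?h ` W'" using slW' S(4) by (intro card_subset_eq) auto
  have "z < ?h f" if "f \<in> W'" for f
  proof -
    have "?h f \<in> ?h ` W - {Min (?h ` W)}" using that eq S(3) by blast
    then have "Min (?h ` W) < ?h f" using slW(1) Min_le[of "?h ` W" "?h f"] by (simp add: less_le)
    moreover obtain f0 where "f0 \<in> W" "Min (?h ` W) = ?h f0" using Min_W by blast
    ultimately show ?thesis using z[of f0] by simp
  qed
  then show ?thesis using W' by blast
qed

text \<open>If no function has slope exactly \<open>z \<eta>\<close>, nothing is lost. Otherwise n
  drops by exactly one: the subseries loses one rank by \<open>SR_raise\<close>, and one lost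
  function g turns dependence of \<open>n + 1\<close> functions into dependence of n functions above
  the new threshold.\<close>

lemma pinned_raise:
  assumes J: "pinned G D x (slopes_ge G x \<Sigma> z) n" and \<eta>: "\<eta> \<in> tang G x"
  shows "\<exists>n'. pinned G D x (slopes_ge G x \<Sigma> (z(\<eta> := z \<eta> + 1))) n'"
proof -
  let ?z = "z(\<eta> := z \<eta> + 1)"
  have iff: "f \<in> slopes_ge G x \<Sigma> ?z \<longleftrightarrow> f \<in> slopes_ge G x \<Sigma> z \<and> z \<eta> < islope G f \<eta>" for f
  proof -
    have "(\<forall>\<xi>\<in>tang G x. ?z \<xi> \<le> islope G f \<xi>) \<longleftrightarrow>
      (\<forall>\<xi>\<in>tang G x. z \<xi> \<le> islope G f \<xi>) \<and> z \<eta> < islope G f \<eta>" (is "?l \<longleftrightarrow> ?r")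
    proof
      assume l: ?l
      have "z \<eta> < islope G f \<eta>" using l[rule_format, OF \<eta>] by simp
      moreover have "z \<xi> \<le> islope G f \<xi>" if "\<xi> \<in> tang G x" for \<xi>
        using l[rule_format, OF that] by (cases "\<xi> = \<eta>") auto
      ultimately show ?r by blast
    qed simp
    then show ?thesis by (simp add: slopes_ge_def)
  qed
  show ?thesis
  proof (cases "\<exists>g\<in>slopes_ge G x \<Sigma> z. islope G g \<eta> = z \<eta>")
    case False
    have "slopes_ge G x \<Sigma> ?z = slopes_ge G x \<Sigma> z"
    proof (rule set_eqI)
      fix f
      have "z \<eta> \<le> islope G f \<eta>" if "f \<in> slopes_ge G x \<Sigma> z" using that \<eta> by (simp add: slopes_ge_def)
      then show "f \<in> slopes_ge G x \<Sigma> ?z \<longleftrightarrow> f \<in> slopes_ge G x \<Sigma> z" using False iff by force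
    qed
    then show ?thesis using J by auto
  next
    case True
    then obtain g where g: "g \<in> slopes_ge G x \<Sigma> z" "islope G g \<eta> = z \<eta>" by blast
    \<comment> \<open>For \<open>n = 0\<close> the singleton of g would be locally dependent, which
      requires two different functions.\<close>
    have "0 < n"
    proof (rule ccontr)
      assume "\<not> 0 < n"
      then have "locdep G x {g}" using J g(1) by (auto simp: pinned_def)
      then show False using locdep_not_inj \<eta> by fastforce
    qed
    then obtain m where n: "n = Suc m" using gr0_conv_Suc by auto
    have "pinned G D x (slopes_ge G x \<Sigma> ?z) m"
      unfolding pinned_def
    proof (intro conjI impI allI)
      assume "0 < m"
      then obtain k where k: "m = Suc k" using gr0_conv_Suc by auto
      obtain W where W: "W \<subseteq> slopes_ge G x \<Sigma> z" "SR G D (Suc k) W"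
        using J by (auto simp: pinned_def n k)
      have "z \<eta> \<le> islope G f \<eta>" if "f \<in> W" for f using that W(1) \<eta> by (auto simp: slopes_ge_def)
      then obtain W' where "W' \<subseteq> W" "SR G D k W'" "\<forall>f\<in>W'. z \<eta> < islope G f \<eta>"
        using SR_raise[OF W(2) \<eta>] by blast
      then show "\<exists>W\<subseteq>slopes_ge G x \<Sigma> ?z. SR G D (m - 1) W"
        using W(1) iff k by (intro exI[of _ W']) auto
    next
      fix S assume S: "S \<subseteq> slopes_ge G x \<Sigma> ?z" "finite S" "card S = Suc m"
      have "g \<notin> S" using S(1) iff g(2) by force
      then have "card (insert g S) = Suc n" "insert g S \<subseteq> slopes_ge G x \<Sigma> z"
        using S iff g(1) by (auto simp: n)
      then have "locdep G x (insert g S)" using J S(2) by (simp add: pinned_def)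
      then obtain M where M: "M \<subseteq> insert g S" "M \<noteq> {}" and
        Mdep: "\<forall>\<xi>\<in>tang G x. \<exists>f\<in>M. \<exists>h\<in>M. f \<noteq> h \<and> islope G f \<xi> = islope G h \<xi> \<and>
          (\<forall>h\<in>M. islope G f \<xi> \<le> islope G h \<xi>)"
        unfolding locdep_def by (elim exE conjE)
      \<comment> \<open>Along \<eta> the slope of g is strictly below that of every member of
        \<open>S\<close>. If g were in \<open>M\<close>, it would attain the least slope
        alone.\<close>
      have "g \<notin> M"
      proof
        assume "g \<in> M"
        obtain f h where fh: "f \<in> M" "h \<in> M" "f \<noteq> h" "islope G f \<eta> = islope G h \<eta>"
          "islope G f \<eta> \<le> z \<eta>"
          using bspec[OF Mdep \<eta>] \<open>g \<in> M\<close> g(2) by metis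
        then have "f \<notin> S" "h \<notin> S" using S(1) iff by force+
        then show False using fh M(1) by blast
      qed
      then have "M \<subseteq> S" using M(1) by blast
      then show "locdep G x S" unfolding locdep_def using M(2) Mdep by blast
    qed
    then show ?thesis by blast
  qed
qed

text \<open>Induction on the total height of the threshold above the vector \<open>L\<close> of
  least slopes. At height 0 the set is all of \<Sigma>, pinned to \<open>r + 1\<close> by the rank
  and condition (2).\<close>

lemma pinned_slopes_ge:
  assumes "SR G D r \<Sigma>"
  shows "\<exists>n. pinned G D x (slopes_ge G x \<Sigma> z) n"
proof -
  note tls = SR_imp_TLS[OF assms]
  define L where "L = (\<lambda>\<eta>. Min ((\<lambda>f. islope G f \<eta>) ` \<Sigma>))"
  have L: "L \<eta> \<le> islope G f \<eta>" if "\<eta> \<in> tang G x" "f \<in> \<Sigma>" for f \<eta>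
    unfolding L_def using TLS_card_slopes(1)[OF mg tls D x that(1)] that(2) by (intro Min_le) auto
  have shifted: "\<exists>n. pinned G D x (slopes_ge G x \<Sigma> (\<lambda>\<eta>. L \<eta> + int (w \<eta>))) n"
    if "(\<Sum>\<eta>\<in>tang G x. w \<eta>) = N" for N and w :: "('v,'e) tang \<Rightarrow> nat"
    using that
  proof (induction N arbitrary: w)
    case 0
    then have "\<And>\<eta>. \<eta> \<in> tang G x \<Longrightarrow> w \<eta> = 0" using finite_tang[OF mg] by simp
    then have "slopes_ge G x \<Sigma> (\<lambda>\<eta>. L \<eta> + int (w \<eta>)) = \<Sigma>" using L by (auto simp: slopes_ge_def)
    moreover have "pinned G D x \<Sigma> (Suc r)"
      using assms TLS_locdep[OF mg tls _ _ _ x] by (auto simp: pinned_def)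
    ultimately show ?case by auto
  next
    case (Suc N)
    then obtain \<eta> where \<eta>: "\<eta> \<in> tang G x" "w \<eta> \<noteq> 0"
      by (metis nat.distinct(1) sum.neutral)
    define w' where "w' = w(\<eta> := w \<eta> - 1)"
    have "(\<Sum>\<xi>\<in>tang G x. w \<xi>) = w \<eta> + (\<Sum>\<xi>\<in>tang G x - {\<eta>}. w \<xi>)"
      "(\<Sum>\<xi>\<in>tang G x. w' \<xi>) = w' \<eta> + (\<Sum>\<xi>\<in>tang G x - {\<eta>}. w' \<xi>)"
      using finite_tang[OF mg] \<eta>(1) by (simp_all add: sum.remove)
    moreover have "(\<Sum>\<xi>\<in>tang G x - {\<eta>}. w' \<xi>) = (\<Sum>\<xi>\<in>tang G x - {\<eta>}. w \<xi>)"
      by (intro sum.cong) (auto simp: w'_def)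
    ultimately have "(\<Sum>\<xi>\<in>tang G x. w' \<xi>) = N" using Suc.prems \<eta>(2) by (simp add: w'_def)
    then obtain n where "pinned G D x (slopes_ge G x \<Sigma> (\<lambda>\<eta>. L \<eta> + int (w' \<eta>))) n"
      using Suc.IH by blast
    from pinned_raise[OF this \<eta>(1)] obtain n' where
      "pinned G D x (slopes_ge G x \<Sigma> ((\<lambda>\<eta>. L \<eta> + int (w' \<eta>))(\<eta> := L \<eta> + int (w' \<eta>) + 1))) n'" by blast
    moreover have "(\<lambda>\<eta>. L \<eta> + int (w' \<eta>))(\<eta> := L \<eta> + int (w' \<eta>) + 1) = (\<lambda>\<eta>. L \<eta> + int (w \<eta>))"
      using \<eta>(2) by (auto simp: w'_def)
    ultimately show ?case by auto
  qed
  \<comment> \<open>Truncation by \<open>nat\<close> replaces z by the maximum of z and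
    \<open>L\<close>, which selects the same functions.\<close>
  obtain n where "pinned G D x (slopes_ge G x \<Sigma> (\<lambda>\<eta>. L \<eta> + int (nat (z \<eta> - L \<eta>)))) n"
    using shifted[OF refl, of "\<lambda>\<eta>. nat (z \<eta> - L \<eta>)"] by blast
  moreover have "slopes_ge G x \<Sigma> (\<lambda>\<eta>. L \<eta> + int (nat (z \<eta> - L \<eta>))) = slopes_ge G x \<Sigma> z"
  proof -
    have "L \<eta> + int (nat (z \<eta> - L \<eta>)) \<le> islope G f \<eta> \<longleftrightarrow> z \<eta> \<le> islope G f \<eta>"
      if "\<eta> \<in> tang G x" "f \<in> \<Sigma>" for f \<eta>
      using L[OF that] by linarith
    then show ?thesis
      unfolding slopes_ge_def by (intro Collect_cong conj_cong ball_cong refl) simp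
  qed
  ultimately show ?thesis by auto
qed

lemma SR_rankable:
  assumes "SR G D r \<Sigma>"
  shows "\<exists>n. \<forall>\<eta>\<in>tang G x. card ((\<lambda>f. islope G f \<eta>) ` slopes_ge G x \<Sigma> z) = n"
proof -
  obtain n where n: "pinned G D x (slopes_ge G x \<Sigma> z) n" using pinned_slopes_ge[OF assms] by blast
  have "finite ((\<lambda>f. islope G f \<eta>) ` slopes_ge G x \<Sigma> z)" if "\<eta> \<in> tang G x" for \<eta>
    using TLS_card_slopes(1)[OF mg SR_imp_TLS[OF assms] D x that]
    by (rule finite_subset[rotated]) (auto simp: slopes_ge_def)
  then show ?thesis using pinned_card_slopes[OF n] by blast
qed

end

section \<open>Functions of prescribed rank\<close>

lemma convergent_subsequence_finite:
  fixes A :: "nat \<Rightarrow> 'a \<Rightarrow> real"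
  assumes "finite F" "\<And>n f. f \<in> F \<Longrightarrow> A n f \<in> {c..d}"
  shows "\<exists>\<phi> l. strict_mono \<phi> \<and> (\<forall>f\<in>F. (\<lambda>n. A (\<phi> n) f) \<longlonglongrightarrow> l f)"
  using assms
proof (induction F)
  case empty
  show ?case by (intro exI[of _ id]) (simp add: strict_mono_def)
next
  case (insert f F)
  then obtain \<phi> l where \<phi>: "strict_mono \<phi>" "\<forall>f\<in>F. (\<lambda>n. A (\<phi> n) f) \<longlonglongrightarrow> l f" by auto
  have "\<forall>n. A (\<phi> n) f \<in> {c..d}" using insert.prems by auto
  then obtain l' \<psi> where \<psi>: "strict_mono \<psi>" "((\<lambda>n. A (\<phi> n) f) \<circ> \<psi>) \<longlonglongrightarrow> l'"
    using compact_imp_seq_compact[OF compact_Icc, of c d, unfolded seq_compact_def, rule_format,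
        of "\<lambda>n. A (\<phi> n) f"] by blast
  have "(\<lambda>n. A (\<phi> (\<psi> n)) h) \<longlonglongrightarrow> (l(f := l')) h" if "h \<in> insert f F" for h
  proof (cases "h = f")
    case True
    then show ?thesis using \<psi>(2) by (simp add: comp_def)
  next
    case False
    then have "(\<lambda>n. A (\<phi> n) h) \<longlonglongrightarrow> l h" using \<phi>(2) that by auto
    from LIMSEQ_subseq_LIMSEQ[OF this \<psi>(1)] show ?thesis using False by (simp add: comp_def)
  qed
  then show ?case
    using strict_mono_o[OF \<phi>(1) \<psi>(1)] by (intro exI[of _ "\<phi> \<circ> \<psi>"] exI[of _ "l(f := l')"])
      (simp add: comp_def)
qed

text \<open>Translating the coefficients and truncating the large ones, which are never attained,
  does not change which functions attain the minimum.\<close>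

lemma Att_normalized:
  assumes F: "finite F" "F \<noteq> {}" and bd: "\<And>f y. f \<in> F \<Longrightarrow> \<bar>f y\<bar> \<le> (C::real)"
  shows "\<exists>a'. (\<forall>f\<in>F. a' f \<in> {0..2 * C + 1}) \<and> (\<forall>y. Att F a' y = Att F a y)"
proof -
  define b where "b = (\<lambda>f. a f - Min (a ` F))"
  \<comment> \<open>The generator h has coefficient 0, so one with coefficient above
    \<open>2 * C\<close> lies above h everywhere. Cutting at \<open>2 * C + 1\<close> preserves this
    strictly.\<close>
  define a' where "a' = (\<lambda>f. min (b f) (2 * C + 1))"
  have "Min (a ` F) \<in> a ` F" using F by (intro Min_in) auto
  then obtain h where h: "h \<in> F" "a h = Min (a ` F)" by auto
  have "0 \<le> C" using bd[OF h(1)] abs_ge_zero order_trans by blast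
  have b: "0 \<le> b f" if "f \<in> F" for f using that F by (simp add: b_def)
  have h0: "b h = 0" "a' h = 0" using h \<open>0 \<le> C\<close> by (simp_all add: b_def a'_def)
  have "Att F a' y = Att F b y" for y
  proof (intro set_eqI iffI)
    fix f assume f: "f \<in> Att F a' y"
    then have fF: "f \<in> F" by (simp add: Att_def)
    have "f y + a' f \<le> h y + a' h" using f h(1) by (simp add: Att_def)
    then have "a' f \<le> 2 * C" using bd[OF fF, of y] bd[OF h(1), of y] h0 by linarith
    then have "a' f = b f" by (simp add: a'_def min_def split: if_splits)
    have "f y + b f \<le> g y + b g" if "g \<in> F" for g
    proof -
      have "f y + a' f \<le> g y + a' g" using f that by (simp add: Att_def)
      moreover have "a' g \<le> b g" by (simp add: a'_def)
      ultimately show ?thesis using \<open>a' f = b f\<close> by linarith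
    qed
    then show "f \<in> Att F b y" using fF by (simp add: Att_def)
  next
    fix f assume f: "f \<in> Att F b y"
    then have fF: "f \<in> F" by (simp add: Att_def)
    have fh: "f y + b f \<le> h y + b h" using f h(1) by (simp add: Att_def)
    then have "b f \<le> 2 * C" using bd[OF fF, of y] bd[OF h(1), of y] h0 by linarith
    then have "a' f = b f" by (simp add: a'_def)
    have "f y + a' f \<le> g y + a' g" if g: "g \<in> F" for g
    proof (cases "b g \<le> 2 * C + 1")
      case True
      then show ?thesis using f g \<open>a' f = b f\<close> by (simp add: Att_def a'_def)
    next
      case False
      then show ?thesis
        using fh h0 bd[OF g, of y] bd[OF h(1), of y] \<open>a' f = b f\<close> by (simp add: a'_def)
    qed
    then show "f \<in> Att F a' y" using fF by (simp add: Att_def)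
  qed
  moreover have "Att F b y = Att F a y" for y by (simp add: Att_def b_def)
  moreover have "a' f \<in> {0..2 * C + 1}" if "f \<in> F" for f
    using b[OF that] \<open>0 \<le> C\<close> by (simp add: a'_def)
  ultimately show ?thesis by (intro exI[of _ a']) auto
qed

context
  fixes G :: "('v,'e) mgraph"
  assumes mg: "metric_graph G"
begin

text \<open>A generator not attaining the minimum at x in the limit misses it by a positive gap. The
  gap persists for coefficients near the limit and, uniformly, for all points within
  \<open>d n\<close> of x.\<close>

lemma Att_limit_subset:
  assumes F: "finite F" "\<And>f. f \<in> F \<Longrightarrow> is_PL G f"
    and x: "x \<in> pts G" "\<eta> \<in> tang G x"
    and l: "\<And>f. f \<in> F \<Longrightarrow> (\<lambda>n. A n f) \<longlonglongrightarrow> l f"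
    and d: "d \<longlonglongrightarrow> 0"
  shows "\<forall>\<^sub>F n in sequentially. Att F (A n) x \<subseteq> Att F l x \<and>
    (\<forall>s\<in>{0<..<d n}. Att F (A n) (along G \<eta> s) \<subseteq> Att F l x)"
proof -
  have "\<forall>\<^sub>F n in sequentially. f \<notin> Att F (A n) x \<and> (\<forall>s\<in>{0<..<d n}. f \<notin> Att F (A n) (along G \<eta> s))"
    if f: "f \<in> F" "f \<notin> Att F l x" for f
  proof -
    obtain g where g: "g \<in> F" "g x + l g < f x + l f" using f by (auto simp: Att_def)
    \<comment> \<open>A quarter of the gap: the values of f and g near x and their two coefficients
      each contribute one error.\<close>
    define \<epsilon> where "\<epsilon> = (f x + l f - (g x + l g)) / 4"
    have \<epsilon>: "0 < \<epsilon>" "4 * \<epsilon> = f x + l f - (g x + l g)" using g(2) by (simp_all add: \<epsilon>_def)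
    have "\<forall>\<^sub>F s in at_right 0. f x - \<epsilon> < f (along G \<eta> s) \<and> g (along G \<eta> s) < g x + \<epsilon>"
      using \<epsilon>(1) order_tendstoD(1)[OF along_tendsto[OF mg x F(2)[OF f(1)]], of "f x - \<epsilon>"]
        order_tendstoD(2)[OF along_tendsto[OF mg x F(2)[OF g(1)]], of "g x + \<epsilon>"]
      by (simp add: eventually_conj_iff)
    then obtain \<delta> where \<delta>: "0 < \<delta>" "\<And>s. 0 < s \<Longrightarrow> s < \<delta> \<Longrightarrow>
        f x - \<epsilon> < f (along G \<eta> s) \<and> g (along G \<eta> s) < g x + \<epsilon>"
      unfolding eventually_at_right_field by auto
    have "\<forall>\<^sub>F n in sequentially. d n < \<delta>" "\<forall>\<^sub>F n in sequentially. l f - \<epsilon> < A n f"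
      "\<forall>\<^sub>F n in sequentially. A n g < l g + \<epsilon>"
      using order_tendstoD(2)[OF d \<delta>(1)] order_tendstoD(1)[OF l[OF f(1)], of "l f - \<epsilon>"]
        order_tendstoD(2)[OF l[OF g(1)], of "l g + \<epsilon>"] \<epsilon>(1) by simp_all
    then show ?thesis
    proof eventually_elim
      case (elim n)
      have "g x + A n g < f x + A n f" using elim \<epsilon> by linarith
      moreover have "g (along G \<eta> s) + A n g < f (along G \<eta> s) + A n f" if "s \<in> {0<..<d n}" for s
        using \<delta>(2)[of s] that elim \<epsilon> by fastforce
      ultimately show ?case using g(1) by (fastforce simp: Att_def)
    qed
  qed
  then have "\<forall>\<^sub>F n in sequentially. \<forall>f\<in>F - Att F l x.
      f \<notin> Att F (A n) x \<and> (\<forall>s\<in>{0<..<d n}. f \<notin> Att F (A n) (along G \<eta> s))"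
    using F(1) by (simp add: eventually_ball_finite_distrib)
  then show ?thesis by (auto elim!: eventually_mono simp: Att_def)
qed

text \<open>The function is a limit of functions that realize dispersed copies of \<open>E\<close>: the functions
  attaining the minimum near \<open>x\<close> before the limit attain it at \<open>x\<close> in the limit.\<close>

lemma TLS_rank_function:
  assumes tls: "TLS G D \<Sigma> r" and D: "is_divisor G D"
    and E: "effective G E" "deg E = int r"
    and \<eta>: "\<And>x. x \<in> pts G \<Longrightarrow> \<eta> x \<in> tang G x"
  shows "\<exists>f\<in>\<Sigma>. bnrp G D f E \<and> (\<forall>x\<in>{x. E x \<noteq> 0}. \<exists>M\<subseteq>\<Sigma>. finite M \<and>
     (\<forall>g\<in>M. \<forall>\<xi>\<in>tang G x. islope G f \<xi> \<le> islope G g \<xi>) \<and>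
     nat (E x) < card ((\<lambda>g. islope G g (\<eta> x)) ` M))"
proof -
  define X where "X = {x. E x \<noteq> 0}"
  have X: "finite X" "{x. E x \<noteq> 0} \<subseteq> X" "X \<subseteq> pts G"
    using E(1) by (auto simp: X_def effective_def is_divisor_def)
  have E0: "0 \<le> E x" for x using E(1) by (simp add: effective_def)
  obtain F where F: "finite F" "F \<noteq> {}" "\<And>f. f \<in> F \<Longrightarrow> is_PL G f" "\<Sigma> = tspan G F" "F \<subseteq> \<Sigma>"
    using TLS_generators[OF mg tls] by blast
  obtain C where C: "\<bar>f y\<bar> \<le> C" if "f \<in> F" for f y
  proof -
    have "bounded (\<Union>g\<in>F. g ` pts G)" using F PL_bounded[OF mg] by (intro bounded_UN) auto
    then obtain C where C: "\<And>g y. g \<in> F \<Longrightarrow> y \<in> pts G \<Longrightarrow> \<bar>g y\<bar> \<le> C"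
      by (fastforce simp: bounded_iff)
    have "\<bar>f y\<bar> \<le> max 0 C" if "f \<in> F" for f y
      using C[OF that, of y] F(3)[OF that] by (cases "y \<in> pts G") (auto simp: is_PL_def)
    then show ?thesis using that by blast
  qed
  let ?slopes = "\<lambda>a \<delta> x. (\<lambda>f. islope G f (\<eta> x)) ` (\<Union>s\<in>{0<..<\<delta>}. Att F a (along G (\<eta> x) s))"
  have "\<exists>a. \<forall>x\<in>X. \<exists>L::int set. finite L \<and> card L = nat (E x) \<and>
     (\<forall>l\<in>L. l < islope G (tcomb G F a) (\<eta> x)) \<and> L \<subseteq> ?slopes a (1 / real (Suc n)) x" for n
    using \<eta> X(3) by (intro TLS_dispersed[OF mg tls D F(1-4) E X]) auto
  then obtain a where a: "\<And>n x. x \<in> X \<Longrightarrow> \<exists>L::int set. finite L \<and> card L = nat (E x) \<and>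
     (\<forall>l\<in>L. l < islope G (tcomb G F (a n)) (\<eta> x)) \<and> L \<subseteq> ?slopes (a n) (1 / real (Suc n)) x"
    by metis
  have "\<exists>a'. (\<forall>f\<in>F. a' f \<in> {0..2 * C + 1}) \<and> (\<forall>y. Att F a' y = Att F (a n) y)" for n
    using C by (intro Att_normalized[OF F(1,2)])
  then obtain A where A: "\<And>n f. f \<in> F \<Longrightarrow> A n f \<in> {0..2 * C + 1}" "\<And>n y. Att F (A n) y = Att F (a n) y"
    by metis
  obtain \<phi> l where \<phi>: "strict_mono \<phi>" "\<forall>f\<in>F. (\<lambda>n. A (\<phi> n) f) \<longlonglongrightarrow> l f"
    using convergent_subsequence_finite[OF F(1), of A 0 "2 * C + 1"] A(1) by blast
  have "(\<lambda>n. 1 / real (Suc (\<phi> n))) \<longlonglongrightarrow> 0"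
    using LIMSEQ_subseq_LIMSEQ[OF LIMSEQ_inverse_real_of_nat \<phi>(1)] by (simp add: comp_def inverse_eq_divide)
  then have "\<forall>\<^sub>F n in sequentially. \<forall>x\<in>X. Att F (A (\<phi> n)) x \<subseteq> Att F l x \<and>
      (\<forall>s\<in>{0<..<1 / real (Suc (\<phi> n))}. Att F (A (\<phi> n)) (along G (\<eta> x) s) \<subseteq> Att F l x)"
    using X \<phi>(2) \<eta>
    by (intro eventually_ball_finite ballI Att_limit_subset[OF F(1,3)]) auto
  then obtain n where n: "\<And>x. x \<in> X \<Longrightarrow> Att F (a (\<phi> n)) x \<subseteq> Att F l x"
    "\<And>x s. x \<in> X \<Longrightarrow> s \<in> {0<..<1 / real (Suc (\<phi> n))} \<Longrightarrow>
       Att F (a (\<phi> n)) (along G (\<eta> x) s) \<subseteq> Att F l x"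
    unfolding A(2) by (metis (no_types, lifting) eventually_sequentially order_refl)
  \<comment> \<open>Only one late index n is needed: all slopes of the limit f are compared with
    those of this single approximant \<open>f'\<close>.\<close>
  define f where "f = tcomb G F l"
  define f' where "f' = tcomb G F (a (\<phi> n))"
  have f\<Sigma>: "f \<in> \<Sigma>" "f' \<in> \<Sigma>" by (auto simp: f_def f'_def F(4) tspan_def)
  then have RD: "f \<in> RD G D" "f' \<in> RD G D" using tls by (auto simp: TLS_def)
  have main: "real_of_int (E x) \<le> real_of_int (D x) + ordv G f x \<and> (\<exists>M\<subseteq>\<Sigma>. finite M \<and>
     (\<forall>g\<in>M. \<forall>\<xi>\<in>tang G x. islope G f \<xi> \<le> islope G g \<xi>) \<and>
     nat (E x) < card ((\<lambda>g. islope G g (\<eta> x)) ` M))" if x: "x \<in> X" for x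
  proof -
    have xp: "x \<in> pts G" using x X by auto
    note \<eta>x = \<eta>[OF xp]
    obtain L :: "int set" where L: "finite L" "card L = nat (E x)" "\<And>l. l \<in> L \<Longrightarrow> l < islope G f' (\<eta> x)"
      "L \<subseteq> ?slopes (a (\<phi> n)) (1 / real (Suc (\<phi> n))) x"
      using a[OF x, of "\<phi> n"] unfolding f'_def by blast
    let ?M = "Att F l x"
    have M: "?M \<subseteq> \<Sigma>" "finite ?M" using F(1,5) by (auto simp: Att_def)
    have low: "islope G f \<xi> \<le> islope G g \<xi>" if "g \<in> ?M" "\<xi> \<in> tang G x" for g \<xi>
      unfolding f_def by (rule islope_tcomb(2)[OF mg F(1-3) xp that(2,1)])
    have slL: "L \<subseteq> (\<lambda>g. islope G g (\<eta> x)) ` ?M"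
      using L(4) n(2)[OF x] by blast
    have att': "\<exists>g\<in>?M. islope G f' \<xi> = islope G g \<xi>" if "\<xi> \<in> tang G x" for \<xi>
      using islope_tcomb(1)[OF mg F(1-3) xp that] n(1)[OF x] unfolding f'_def by blast
    have "insert (islope G f' (\<eta> x)) L \<subseteq> (\<lambda>g. islope G g (\<eta> x)) ` ?M"
      using slL att'[OF \<eta>x] by auto
    then have "card (insert (islope G f' (\<eta> x)) L) \<le> card ((\<lambda>g. islope G g (\<eta> x)) ` ?M)"
      using M(2) by (intro card_mono) auto
    moreover have "islope G f' (\<eta> x) \<notin> L" using L(3) by blast
    ultimately have card: "nat (E x) < card ((\<lambda>g. islope G g (\<eta> x)) ` ?M)" using L(1,2) by simp
    \<comment> \<open>At x the functions attaining the minimum for \<open>f'\<close> also attain it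
      for f, so passing to the limit can only lower slopes.\<close>
    have le: "islope G f \<xi> \<le> islope G f' \<xi>" if "\<xi> \<in> tang G x" for \<xi>
      using att'[OF that] low[OF _ that] by auto
    have "islope G f (\<eta> x) \<le> l'" if l': "l' \<in> L" for l'
    proof -
      obtain g where "g \<in> ?M" "l' = islope G g (\<eta> x)" using l' slL by blast
      then show ?thesis using low \<eta>x by blast
    qed
    \<comment> \<open>\<open>E x\<close> distinct integers fit between the slopes of f and
      \<open>f'\<close> along \<open>\<eta> x\<close>, so the slope drops by at least
      \<open>E x\<close>. No other slope rises, and \<open>f'\<close> already lies in
      \<open>R(D)\<close>; hence the order of f at x is large enough.\<close>
    then have "L \<subseteq> {islope G f (\<eta> x)..<islope G f' (\<eta> x)}" using L(3) by auto
    then have "card L \<le> card {islope G f (\<eta> x)..<islope G f' (\<eta> x)}" by (intro card_mono) auto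
    then have drop: "islope G f (\<eta> x) + E x \<le> islope G f' (\<eta> x)"
      using L(2) E0[of x] le[OF \<eta>x] by simp
    have ord: "ordv G h x = - of_int (\<Sum>\<xi>\<in>tang G x. islope G h \<xi>)" if "h \<in> RD G D" for h
    proof -
      have "is_PL G h" using that by (simp add: RD_def)
      then have "(\<Sum>\<xi>\<in>tang G x. slope G h \<xi>) = (\<Sum>\<xi>\<in>tang G x. of_int (islope G h \<xi>))"
        using germ_islope(2)[OF mg xp] by (intro sum.cong) auto
      then show ?thesis by (simp add: ordv_def)
    qed
    have "(\<Sum>\<xi>\<in>tang G x - {\<eta> x}. islope G f \<xi>) \<le> (\<Sum>\<xi>\<in>tang G x - {\<eta> x}. islope G f' \<xi>)"
      using le by (intro sum_mono) auto
    then have "(\<Sum>\<xi>\<in>tang G x. islope G f \<xi>) + E x \<le> (\<Sum>\<xi>\<in>tang G x. islope G f' \<xi>)"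
      using drop by (simp add: sum.remove[OF finite_tang[OF mg] \<eta>x])
    moreover have "0 \<le> D x - (\<Sum>\<xi>\<in>tang G x. islope G f' \<xi>)"
    proof -
      have "0 \<le> real_of_int (D x) + ordv G f' x" using RD(2) xp by (simp add: RD_def)
      then show ?thesis unfolding ord[OF RD(2)] by linarith
    qed
    ultimately have "E x \<le> D x - (\<Sum>\<xi>\<in>tang G x. islope G f \<xi>)" by linarith
    then have "real_of_int (E x) \<le> real_of_int (D x) + ordv G f x" unfolding ord[OF RD(1)] by linarith
    then show ?thesis using M low card by blast
  qed
  have "bnrp G D f E"
    unfolding bnrp_def
  proof
    fix x assume "x \<in> pts G"
    show "real_of_int (E x) \<le> real_of_int (D x) + ordv G f x"
    proof (cases "x \<in> X")
      case False
      then show ?thesis using RD(1) \<open>x \<in> pts G\<close> by (simp add: X_def RD_def)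
    qed (use main in blast)
  qed
  then show ?thesis using f\<Sigma>(1) main unfolding X_def by blast
qed

end

section \<open>The slope structure of a strongly recursive series\<close>

lemma strict_mono_on_card_less:
  fixes h :: "nat \<Rightarrow> int"
  assumes "strict_mono_on {0..r} h" "i \<le> r"
  shows "card {s \<in> h ` {0..r}. s < h i} = i"
proof -
  have "{s \<in> h ` {0..r}. s < h i} = h ` {0..<i}"
    using assms by (auto simp: strict_mono_on_less image_iff)
  moreover have "inj_on h {0..<i}"
    using strict_mono_on_imp_inj_on[OF assms(1)] by (rule inj_on_subset) (use assms(2) in auto)
  ultimately show ?thesis by (simp add: card_image)
qed

text \<open>The index of a value is the number of smaller values in the range, so an increasing
  enumeration is determined by its range.\<close>

lemma strict_mono_on_unique:
  fixes h k :: "nat \<Rightarrow> int"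
  assumes "strict_mono_on {0..r} h" "strict_mono_on {0..r} k" "h ` {0..r} = k ` {0..r}" "i \<le> r"
  shows "h i = k i"
proof -
  have "h i \<in> h ` {0..r}" using assms(4) by simp
  then obtain j where j: "j \<le> r" "h i = k j" unfolding assms(3) by auto
  have "i = j"
    using strict_mono_on_card_less[OF assms(1,4)] strict_mono_on_card_less[OF assms(2) j(1)]
    by (simp add: assms(3) j(2))
  then show ?thesis using j by simp
qed

definition slope_enum :: "('v,'e) mgraph \<Rightarrow> (('v,'e) gpt \<Rightarrow> real) set \<Rightarrow> ('v,'e) tang \<Rightarrow> nat \<Rightarrow> int" where
  "slope_enum G \<Sigma> \<eta> i = sorted_list_of_set ((\<lambda>f. islope G f \<eta>) ` \<Sigma>) ! i"

definition tang_enum :: "('v,'e) mgraph \<Rightarrow> ('v,'e) gpt \<Rightarrow> nat \<Rightarrow> ('v,'e) tang" where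
  "tang_enum G x = (SOME h. bij_betw h {0..<val G x} (tang G x))"

definition dot_array :: "('v,'e) mgraph \<Rightarrow> nat \<Rightarrow> (('v,'e) gpt \<Rightarrow> real) set \<Rightarrow> ('v,'e) gpt \<Rightarrow> nat list set" where
  "dot_array G r \<Sigma> x = (\<lambda>f. dvec G r (slope_enum G \<Sigma>) (tang_enum G) f x) ` \<Sigma>"

lemma length_dvec: "length (dvec G r S ordr f x) = val G x"
  by (simp add: dvec_def)

context
  fixes G :: "('v,'e) mgraph"
  assumes mg: "metric_graph G"
begin

lemma tang_enum:
  shows "bij_betw (tang_enum G x) {0..<val G x} (tang G x)"
  unfolding tang_enum_def val_def
  by (rule someI_ex[OF ex_bij_betw_nat_finite[OF finite_tang[OF mg]]])

lemma tang_enum_mem: "k < val G x \<Longrightarrow> tang_enum G x k \<in> tang G x"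
  using bij_betwE[OF tang_enum] by simp

lemma val_pos: "x \<in> pts G \<Longrightarrow> 0 < val G x"
  using tang_nonempty[OF mg] finite_tang[OF mg] by (simp add: val_def card_gt_0_iff)

end

context
  fixes G :: "('v,'e) mgraph" and D :: "('v,'e) gpt \<Rightarrow> int"
    and \<Sigma> :: "(('v,'e) gpt \<Rightarrow> real) set" and r :: nat
  assumes mg: "metric_graph G" and D: "is_divisor G D" and SR: "SR G D r \<Sigma>"
begin

lemma slope_enum:
  assumes "x \<in> pts G" "\<eta> \<in> tang G x"
  shows "strict_mono_on {0..r} (slope_enum G \<Sigma> \<eta>)"
    and "slope_enum G \<Sigma> \<eta> ` {0..r} = (\<lambda>f. islope G f \<eta>) ` \<Sigma>"
proof -
  let ?L = "sorted_list_of_set ((\<lambda>f. islope G f \<eta>) ` \<Sigma>)"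
  note sl = TLS_card_slopes[OF mg SR_imp_TLS[OF SR] D assms]
  have len: "length ?L = Suc r" and set: "set ?L = (\<lambda>f. islope G f \<eta>) ` \<Sigma>"
    using sl by simp_all
  have "sorted_wrt (<) ?L" by simp
  then show "strict_mono_on {0..r} (slope_enum G \<Sigma> \<eta>)"
    using len by (auto simp: strict_mono_on_def slope_enum_def sorted_wrt_iff_nth_less)
  have "slope_enum G \<Sigma> \<eta> ` {0..r} = (!) ?L ` {..<length ?L}"
    unfolding len slope_enum_def by (intro image_cong) auto
  then show "slope_enum G \<Sigma> \<eta> ` {0..r} = (\<lambda>f. islope G f \<eta>) ` \<Sigma>"
    using set by (simp add: set_conv_nth lessThan_def image_Collect)
qed

lemma slope_enum_less:
  assumes "x \<in> pts G" "\<eta> \<in> tang G x" "i \<le> r" "j \<le> r"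
  shows "slope_enum G \<Sigma> \<eta> i \<le> slope_enum G \<Sigma> \<eta> j \<longleftrightarrow> i \<le> j"
  using strict_mono_on_less_eq[OF slope_enum(1)[OF assms(1,2)]] assms(3,4) by simp

abbreviation dv :: "(('v,'e) gpt \<Rightarrow> real) \<Rightarrow> ('v,'e) gpt \<Rightarrow> nat list" where
  "dv \<equiv> dvec G r (slope_enum G \<Sigma>) (tang_enum G)"

lemma PL_mem: "f \<in> \<Sigma> \<Longrightarrow> is_PL G f"
  using SR_imp_TLS[OF SR] by (auto simp: TLS_def RD_def)

lemma dv_nth:
  assumes x: "x \<in> pts G" and k: "k < val G x" and f: "f \<in> \<Sigma>"
  shows "dv f x ! k \<le> r" "slope_enum G \<Sigma> (tang_enum G x k) (dv f x ! k) = islope G f (tang_enum G x k)"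
proof -
  let ?\<eta> = "tang_enum G x k"
  have \<eta>: "?\<eta> \<in> tang G x" using tang_enum_mem[OF mg k] .
  have sl: "slope G f ?\<eta> = of_int (islope G f ?\<eta>)" by (rule germ_islope(2)[OF mg x \<eta> PL_mem[OF f]])
  have "islope G f ?\<eta> \<in> slope_enum G \<Sigma> ?\<eta> ` {0..r}" using slope_enum(2)[OF x \<eta>] f by blast
  then obtain j where j: "j \<le> r" "slope_enum G \<Sigma> ?\<eta> j = islope G f ?\<eta>" by auto
  have "(THE j. j \<le> r \<and> real_of_int (slope_enum G \<Sigma> ?\<eta> j) = slope G f ?\<eta>) = j"
  proof (rule the_equality)
    fix i assume "i \<le> r \<and> real_of_int (slope_enum G \<Sigma> ?\<eta> i) = slope G f ?\<eta>"
    then show "i = j" using j sl slope_enum_less[OF x \<eta>, of i j] slope_enum_less[OF x \<eta>, of j i] by simp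
  qed (use j sl in auto)
  then have "dv f x ! k = j" using k by (simp add: dvec_def)
  then show "dv f x ! k \<le> r" "slope_enum G \<Sigma> ?\<eta> (dv f x ! k) = islope G f ?\<eta>" using j by auto
qed

lemma dv_le_iff:
  assumes "x \<in> pts G" "k < val G x" "f \<in> \<Sigma>" "j \<le> r"
  shows "j \<le> dv f x ! k \<longleftrightarrow> slope_enum G \<Sigma> (tang_enum G x k) j \<le> islope G f (tang_enum G x k)"
  using slope_enum_less[OF assms(1) tang_enum_mem[OF mg assms(2)] assms(4) dv_nth(1)[OF assms(1-3)]]
    dv_nth(2)[OF assms(1-3)] by simp

lemma dle_dv_iff:
  assumes "x \<in> pts G" "f \<in> \<Sigma>" "g \<in> \<Sigma>"
  shows "dle (dv f x) (dv g x) \<longleftrightarrow> (\<forall>\<eta>\<in>tang G x. islope G f \<eta> \<le> islope G g \<eta>)"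
proof -
  have "dle (dv f x) (dv g x) \<longleftrightarrow> (\<forall>k<val G x. dv f x ! k \<le> dv g x ! k)"
    by (simp add: dle_def length_dvec)
  also have "\<dots> \<longleftrightarrow> (\<forall>k<val G x. islope G f (tang_enum G x k) \<le> islope G g (tang_enum G x k))"
    using dv_le_iff[OF assms(1) _ assms(3)] dv_nth[OF assms(1) _ assms(2)] by auto
  also have "\<dots> \<longleftrightarrow> (\<forall>\<eta>\<in>tang_enum G x ` {0..<val G x}. islope G f \<eta> \<le> islope G g \<eta>)" by auto
  finally show ?thesis using bij_betw_imp_surj_on[OF tang_enum[OF mg]] by simp
qed

text \<open>Carries slope counts over to dot arrays: the enumeration of slopes is injective on
  indices.\<close>

lemma card_dv_coord:
  assumes "x \<in> pts G" "k < val G x" "M \<subseteq> \<Sigma>"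
  shows "card ((\<lambda>y. y ! k) ` (\<lambda>f. dv f x) ` M) = card ((\<lambda>f. islope G f (tang_enum G x k)) ` M)"
proof -
  let ?c = "(\<lambda>y. y ! k) ` (\<lambda>f. dv f x) ` M" and ?s = "slope_enum G \<Sigma> (tang_enum G x k)"
  have "?c \<subseteq> {0..r}" using dv_nth(1)[OF assms(1,2)] assms(3) by auto
  then have "inj_on ?s ?c"
    using strict_mono_on_imp_inj_on[OF slope_enum(1)[OF assms(1) tang_enum_mem[OF mg assms(2)]]]
      inj_on_subset by blast
  then have "card ?c = card (?s ` ?c)" by (simp add: card_image)
  also have "?s ` ?c = (\<lambda>f. islope G f (tang_enum G x k)) ` M"
    unfolding image_image using dv_nth(2)[OF assms(1,2)] assms(3) by (intro image_cong) auto
  finally show ?thesis .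
qed

lemma dot_array_grid:
  assumes "x \<in> pts G"
  shows "dot_array G r \<Sigma> x \<subseteq> grid r (val G x)"
  using dv_nth(1)[OF assms] by (auto simp: dot_array_def grid_def length_dvec)

lemma dot_array_rankable:
  assumes x: "x \<in> pts G" and y: "length y = val G x"
  shows "\<exists>s. rankable (val G x) (psub (dot_array G r \<Sigma> x) y) s"
proof -
  \<comment> \<open>Entries of y beyond r name no slope. They are sent to the largest slope plus
    one, a threshold that no function reaches.\<close>
  define z where "z = (\<lambda>\<eta>. let j = y ! inv_into {0..<val G x} (tang_enum G x) \<eta>
    in if j \<le> r then slope_enum G \<Sigma> \<eta> j else slope_enum G \<Sigma> \<eta> r + 1)"
  have z: "z (tang_enum G x k) \<le> islope G f (tang_enum G x k) \<longleftrightarrow> y ! k \<le> dv f x ! k"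
    if k: "k < val G x" and f: "f \<in> \<Sigma>" for k f
  proof -
    have inv: "inv_into {0..<val G x} (tang_enum G x) (tang_enum G x k) = k"
      using bij_betw_imp_inj_on[OF tang_enum[OF mg]] k by (intro inv_into_f_f) auto
    show ?thesis
    proof (cases "y ! k \<le> r")
      case True
      then show ?thesis using dv_le_iff[OF x k f True] by (simp add: z_def inv)
    next
      case False
      have "islope G f (tang_enum G x k) \<le> slope_enum G \<Sigma> (tang_enum G x k) r"
        using slope_enum_less[OF x tang_enum_mem[OF mg k] dv_nth(1)[OF x k f], of r] dv_nth[OF x k f] by simp
      then show ?thesis using False dv_nth(1)[OF x k f] by (simp add: z_def inv)
    qed
  qed
  let ?M = "slopes_ge G x \<Sigma> z"
  have "f \<in> ?M \<longleftrightarrow> dle y (dv f x)" if "f \<in> \<Sigma>" for f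
  proof -
    have "f \<in> ?M \<longleftrightarrow> (\<forall>\<eta>\<in>tang_enum G x ` {0..<val G x}. z \<eta> \<le> islope G f \<eta>)"
      using that bij_betw_imp_surj_on[OF tang_enum[OF mg]] by (simp add: slopes_ge_def)
    also have "\<dots> \<longleftrightarrow> dle y (dv f x)" using z that by (auto simp: dle_def y length_dvec)
    finally show ?thesis .
  qed
  then have "psub (dot_array G r \<Sigma> x) y = (\<lambda>f. dv f x) ` ?M"
    by (auto simp: psub_def dot_array_def slopes_ge_def)
  moreover obtain n where "\<forall>\<eta>\<in>tang G x. card ((\<lambda>f. islope G f \<eta>) ` ?M) = n"
    using SR_rankable[OF mg D x SR] by blast
  moreover have "?M \<subseteq> \<Sigma>" by (auto simp: slopes_ge_def)
  ultimately have "rankable (val G x) (psub (dot_array G r \<Sigma> x) y) (int n - 1)"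
    using card_dv_coord[OF x] tang_enum_mem[OF mg] by (simp add: rankable_def rk_def)
  then show ?thesis by blast
qed

lemma perm_array_dot_array:
  assumes x: "x \<in> pts G"
  shows "perm_array r (val G x) (nondom (dot_array G r \<Sigma> x))"
proof (rule nondom_perm_array[OF dot_array_grid[OF x] dot_array_rankable[OF x]])
  fix k assume k: "k < val G x"
  show "card ((\<lambda>y. y ! k) ` dot_array G r \<Sigma> x) = Suc r"
    unfolding dot_array_def card_dv_coord[OF x k order_refl]
    by (rule TLS_card_slopes(2)[OF mg SR_imp_TLS[OF SR] D x tang_enum_mem[OF mg k]])
qed

lemma compatible_dot_array:
  assumes f: "f \<in> \<Sigma>"
  shows "compatible G r (slope_enum G \<Sigma>) (tang_enum G) (\<lambda>x. nondom (dot_array G r \<Sigma> x)) f"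
  unfolding compatible_def
proof (intro conjI ballI)
  show "is_PL G f" by (rule PL_mem[OF f])
  fix x assume x: "x \<in> pts G"
  show "dv f x \<in> nondom (dot_array G r \<Sigma> x) \<union> Rset (val G x) (nondom (dot_array G r \<Sigma> x))"
    using nondom_closure[OF dot_array_grid[OF x] dot_array_rankable[OF x] val_pos[OF mg x]] f
    by (auto simp: dot_array_def)
  fix \<eta> assume \<eta>: "\<eta> \<in> tang G x"
  show "slope G f \<eta> \<in> real_of_int ` slope_enum G \<Sigma> \<eta> ` {0..r}"
    unfolding slope_enum(2)[OF x \<eta>] germ_islope(2)[OF mg x \<eta> PL_mem[OF f]] using f by blast
qed

text \<open>The functions in \<open>M\<close> give points of the principal subarray at the vector of
  f, and passing to nondominated points retains their coordinates. The rank is one less than the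
  number of values.\<close>

lemma rho_ge:
  assumes x: "x \<in> pts G" and f: "f \<in> \<Sigma>" and M: "M \<subseteq> \<Sigma>"
    and ge: "\<forall>g\<in>M. \<forall>\<xi>\<in>tang G x. islope G f \<xi> \<le> islope G g \<xi>"
  shows "int (card ((\<lambda>g. islope G g (tang_enum G x 0)) ` M)) - 1
    \<le> rho G r (slope_enum G \<Sigma>) (tang_enum G) (\<lambda>x. nondom (dot_array G r \<Sigma> x)) f x"
proof -
  let ?A = "psub (dot_array G r \<Sigma> x) (dv f x)"
  note v = val_pos[OF mg x]
  have "finite ?A"
    using dot_array_grid[OF x] finite_grid finite_subset by (fastforce simp: psub_def)
  moreover have "(\<lambda>g. dv g x) ` M \<subseteq> ?A"
    using M ge dle_dv_iff[OF x f] by (auto simp: psub_def dot_array_def)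
  ultimately have "card ((\<lambda>y. y ! 0) ` (\<lambda>g. dv g x) ` M) \<le> card ((\<lambda>y. y ! 0) ` ?A)"
    by (intro card_mono image_mono) auto
  then show ?thesis
    unfolding card_dv_coord[OF x v M]
    by (simp add: rho_def rank_arr_def rk_def
        nondom_coord[OF dot_array_grid[OF x] dot_array_rankable[OF x] v])
qed

end

section \<open>Points where the generators are affine\<close>

definition affine_at :: "(('v,'e) gpt \<Rightarrow> real) \<Rightarrow> 'e \<Rightarrow> real \<Rightarrow> bool" where
  "affine_at f e t \<longleftrightarrow> (\<exists>m :: int. \<exists>c :: real. \<forall>\<^sub>F u in nhds t. f (GE e u) = of_int m * u + c)"

lemma affine_at_germ:
  assumes "\<forall>\<^sub>F u in nhds t. f (GE e u) = of_int m * u + c"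
  shows "germ G f (GE e t, b, e) (if b then m else - m)"
proof -
  have lim: "((\<lambda>s. t + (if b then s else - s)) \<longlongrightarrow> t) (at_right 0)"
  proof -
    have "((\<lambda>s. t + s) \<longlongrightarrow> t + 0) (at_right 0)" "((\<lambda>s. t + - s) \<longlongrightarrow> t + - 0) (at_right 0)"
      by (intro tendsto_intros)+
    then show ?thesis by (cases b) simp_all
  qed
  have "\<forall>\<^sub>F s in at_right 0. f (GE e (t + (if b then s else - s))) = of_int m * (t + (if b then s else - s)) + c"
    using eventually_compose_filterlim[OF assms lim] .
  moreover have "f (GE e t) = of_int m * t + c" using assms by (rule eventually_nhds_x_imp_x)
  ultimately show ?thesis
    by (auto elim!: eventually_mono simp: germ_def along_def tpos_def algebra_simps)
qed

lemma tang_interior: "(GE e u, b, e) \<in> tang G (GE e u)"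
  by (cases b) (auto simp: tang_def)

lemma val_interior: "val G (GE e t) = 2"
  by (simp add: val_def tang_def)

text \<open>The ordering of directions is an arbitrary choice, so which way coordinate 0 points is
  unknown. The facts at affine points are therefore stated for either b.\<close>

lemma tang_enum_interior:
  assumes "metric_graph G"
  shows "\<exists>b. tang_enum G (GE e t) 0 = (GE e t, b, e) \<and> tang_enum G (GE e t) 1 = (GE e t, \<not> b, e)"
proof -
  note bij = tang_enum[OF assms, of "GE e t", unfolded val_interior]
  have "tang_enum G (GE e t) 0 \<in> tang G (GE e t)" "tang_enum G (GE e t) 1 \<in> tang G (GE e t)"
    using bij_betwE[OF bij] by auto
  moreover have "tang_enum G (GE e t) 0 \<noteq> tang_enum G (GE e t) 1"
    using inj_onD[OF bij_betw_imp_inj_on[OF bij], of 0 1] by auto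
  ultimately show ?thesis by (auto simp: tang_def)
qed

lemma affine_at_islope:
  assumes mg: "metric_graph G" and e: "e \<in> edges G" "0 < t" "t < elen G e" and f: "affine_at f e t"
  shows "islope G f (GE e t, \<not> b, e) = - islope G f (GE e t, b, e)"
    and "\<forall>\<^sub>F u in at t. islope G f (GE e u, b, e) = islope G f (GE e t, b, e)"
proof -
  obtain m c where mc: "\<forall>\<^sub>F u in nhds t. f (GE e u) = of_int (m::int) * u + c"
    using f unfolding affine_at_def by blast
  have isl: "islope G f (GE e u, b, e) = (if b then m else - m)"
    if "\<forall>\<^sub>F v in nhds u. f (GE e v) = of_int m * v + c" "0 < u" "u < elen G e" for u b
    by (rule germ_slope(2)[OF mg _ _ affine_at_germ[OF that(1)]])
      (use that e in \<open>auto simp: pts_def tang_def\<close>)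
  show "islope G f (GE e t, \<not> b, e) = - islope G f (GE e t, b, e)"
    using isl[OF mc e(2,3)] by simp
  \<comment> \<open>Being affine is an open condition: the same m and c serve at all nearby
    points.\<close>
  have "\<forall>\<^sub>F u in nhds t. \<forall>\<^sub>F v in nhds u. f (GE e v) = of_int m * v + c"
    using mc by (simp add: eventually_eventually)
  moreover have "\<forall>\<^sub>F u in nhds t. u \<in> {0<..<elen G e}" using e by (intro eventually_nhds_in_open) auto
  ultimately have "\<forall>\<^sub>F u in nhds t. islope G f (GE e u, b, e) = islope G f (GE e t, b, e)"
    by eventually_elim (use isl isl[OF mc e(2,3)] in auto)
  then show "\<forall>\<^sub>F u in at t. islope G f (GE e u, b, e) = islope G f (GE e t, b, e)"
    by (simp add: eventually_nhds_conv_at)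
qed

context
  fixes G :: "('v,'e) mgraph" and D :: "('v,'e) gpt \<Rightarrow> int"
    and \<Sigma> F :: "(('v,'e) gpt \<Rightarrow> real) set" and r :: nat and e :: 'e and t :: real
  assumes mg: "metric_graph G" and D: "is_divisor G D" and SR: "SR G D r \<Sigma>"
    and F: "finite F" "F \<noteq> {}" "\<And>f. f \<in> F \<Longrightarrow> is_PL G f" "\<Sigma> = tspan G F" "F \<subseteq> \<Sigma>"
    and e: "e \<in> edges G" "0 < t" "t < elen G e" and aff: "\<And>f. f \<in> F \<Longrightarrow> affine_at f e t"
begin

lemma interior_pts: "0 < u \<Longrightarrow> u < elen G e \<Longrightarrow> GE e u \<in> pts G"
  using e by (auto simp: pts_def)

lemma slope_enum_generators:
  assumes "x \<in> pts G" "\<eta> \<in> tang G x"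
  shows "slope_enum G \<Sigma> \<eta> ` {0..r} = (\<lambda>f. islope G f \<eta>) ` F"
  using slope_enum(2)[OF mg D SR assms] islope_span[OF mg F(1-3) assms] F(4) by simp

lemma Sset_locally_constant:
  "\<forall>\<^sub>F u in at t. Sset r (slope_enum G \<Sigma>) (GE e u, b, e) = Sset r (slope_enum G \<Sigma>) (GE e t, b, e)"
proof -
  have "\<forall>\<^sub>F u in at t. \<forall>f\<in>F. islope G f (GE e u, b, e) = islope G f (GE e t, b, e)"
    using affine_at_islope(2)[OF mg e aff] F(1) by (simp add: eventually_ball_finite_distrib)
  moreover have "\<forall>\<^sub>F u in at t. u \<in> {0<..<elen G e}"
    using e by (intro eventually_at_in_open') auto
  ultimately show ?thesis
  proof eventually_elim
    case (elim u)
    then have "GE e u \<in> pts G" using interior_pts by simp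
    then show ?case
      using elim(1) slope_enum_generators[OF _ tang_interior] interior_pts[OF e(2,3)]
      by (simp add: Sset_def)
  qed
qed

text \<open>The generators are affine here, so the two slope sets are negatives of each other.
  Negating and reversing one enumeration gives an increasing enumeration of the other set, which is
  unique.\<close>

lemma slope_enum_opposite:
  assumes "i \<le> r"
  shows "slope_enum G \<Sigma> (GE e t, b, e) i + slope_enum G \<Sigma> (GE e t, \<not> b, e) (r - i) = 0"
proof -
  let ?x = "GE e t"
  have x: "?x \<in> pts G" using interior_pts e by simp
  let ?s = "slope_enum G \<Sigma> (?x, \<not> b, e)"
  note mono = slope_enum(1)[OF mg D SR x tang_interior]
  have "strict_mono_on {0..r} (\<lambda>i. - ?s (r - i))"
    using mono[of "\<not> b"] by (auto simp: strict_mono_on_def)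
  moreover have "(\<lambda>i. - ?s (r - i)) ` {0..r} = slope_enum G \<Sigma> (?x, b, e) ` {0..r}"
  proof -
    have "(\<lambda>i. r - i) ` {0..r} = {0..r}"
    proof
      show "{0..r} \<subseteq> (\<lambda>i. r - i) ` {0..r}"
      proof
        fix j assume "j \<in> {0..r}"
        then have "j = r - (r - j)" "r - j \<in> {0..r}" by auto
        then show "j \<in> (\<lambda>i. r - i) ` {0..r}" by blast
      qed
    qed auto
    then have "(\<lambda>i. - ?s (r - i)) ` {0..r} = uminus ` ?s ` {0..r}"
      by (metis (no_types, lifting) image_cong image_image)
    also have "\<dots> = (\<lambda>f. islope G f (?x, b, e)) ` F"
      using slope_enum_generators[OF x tang_interior] affine_at_islope(1)[OF mg e aff]
      by (simp add: image_image)
    finally show ?thesis using slope_enum_generators[OF x tang_interior] by simp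
  qed
  ultimately have "slope_enum G \<Sigma> (?x, b, e) i = - ?s (r - i)"
    using strict_mono_on_unique[OF mono _ _ assms] by metis
  then show ?thesis by simp
qed

text \<open>A combination is a minimum of functions affine at t. The generator providing its slope
  one way bounds its slope the other way by the negative.\<close>

lemma islope_concave:
  assumes "g \<in> \<Sigma>"
  shows "islope G g (GE e t, b, e) + islope G g (GE e t, \<not> b, e) \<le> 0"
proof -
  have x: "GE e t \<in> pts G" using interior_pts e by simp
  obtain a where a: "g = tcomb G F a" using assms F(4) by (auto simp: tspan_def)
  obtain f where f: "f \<in> Att F a (GE e t)" "islope G g (GE e t, b, e) = islope G f (GE e t, b, e)"
    using islope_tcomb(1)[OF mg F(1-3) x tang_interior] a by metis
  have "islope G g (GE e t, \<not> b, e) \<le> islope G f (GE e t, \<not> b, e)"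
    unfolding a by (rule islope_tcomb(2)[OF mg F(1-3) x tang_interior f(1)])
  moreover have "f \<in> F" using f by (simp add: Att_def)
  ultimately show ?thesis using affine_at_islope(1)[OF mg e aff] f(2) by simp
qed

text \<open>By concavity the array lies on or below the antidiagonal. Every slope is realized by a
  generator, and generators do not bend here, so they fill the antidiagonal.\<close>

lemma nondom_dot_array_interior: "nondom (dot_array G r \<Sigma> (GE e t)) = std_perm r 2"
proof (rule nondom_std_perm)
  let ?x = "GE e t"
  have x: "?x \<in> pts G" using interior_pts e by simp
  obtain b where b: "tang_enum G ?x 0 = (?x, b, e)" "tang_enum G ?x 1 = (?x, \<not> b, e)"
    using tang_enum_interior[OF mg] by blast
  let ?s = "slope_enum G \<Sigma>"
  let ?dv = "\<lambda>f. dvec G r ?s (tang_enum G) f ?x"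
  have v: "0 < val G ?x" "1 < val G ?x" by (simp_all add: val_interior)
  note nth0 = dv_nth[OF mg D SR x v(1), unfolded b]
  note nth1 = dv_nth[OF mg D SR x v(2), unfolded b]
  show "dot_array G r \<Sigma> ?x \<subseteq> grid r 2" using dot_array_grid[OF mg D SR x] by (simp add: val_interior)
  show "y ! 0 + y ! 1 \<le> r" if y: "y \<in> dot_array G r \<Sigma> ?x" for y
  proof -
    obtain g where g: "g \<in> \<Sigma>" "y = ?dv g" using y by (auto simp: dot_array_def)
    have "?s (?x, \<not> b, e) (y ! 1) \<le> - ?s (?x, b, e) (y ! 0)"
      using islope_concave[OF g(1), of b] nth0(2)[OF g(1)] nth1(2)[OF g(1)] g(2) by simp
    also have "\<dots> = ?s (?x, \<not> b, e) (r - y ! 0)"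
      using slope_enum_opposite[of "y ! 0" b] nth0(1)[OF g(1)] g(2) by simp
    finally have "y ! 1 \<le> r - y ! 0"
      using slope_enum_less[OF mg D SR x tang_interior] nth1(1)[OF g(1)] g(2) by simp
    then show ?thesis using nth0(1)[OF g(1)] g(2) by simp
  qed
  show "std_perm r 2 \<subseteq> dot_array G r \<Sigma> ?x"
  proof
    fix y assume y: "y \<in> std_perm r 2"
    then have ly: "length y = 2" by (simp add: std_perm_def grid_def)
    then obtain p q where "y = [p, q]" by (auto simp: length_Suc_conv numeral_2_eq_2)
    then have sum: "y ! 0 + y ! 1 = r" using y by (simp add: std_perm_def)
    then have "?s (?x, b, e) (y ! 0) \<in> (\<lambda>f. islope G f (?x, b, e)) ` F"
      using slope_enum_generators[OF x tang_interior] by force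
    then obtain f where f: "f \<in> F" "islope G f (?x, b, e) = ?s (?x, b, e) (y ! 0)" by auto
    have f\<Sigma>: "f \<in> \<Sigma>" using f F(5) by blast
    have "islope G f (?x, \<not> b, e) = ?s (?x, \<not> b, e) (y ! 1)"
      using affine_at_islope(1)[OF mg e aff[OF f(1)], of b] f(2) slope_enum_opposite[of "y ! 0" b] sum
      by (simp add: add.commute add_eq_0_iff flip: sum)
    then have 1: "?s (?x, \<not> b, e) (?dv f ! 1) = ?s (?x, \<not> b, e) (y ! 1)"
      using nth1(2)[OF f\<Sigma>] by simp
    have 0: "?s (?x, b, e) (?dv f ! 0) = ?s (?x, b, e) (y ! 0)" using nth0(2)[OF f\<Sigma>] f(2) by simp
    have inj: "i = j" if "?s (?x, b', e) i = ?s (?x, b', e) j" "i \<le> r" "j \<le> r" for b' i j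
      using that slope_enum_less[OF mg D SR x tang_interior, of i j b']
        slope_enum_less[OF mg D SR x tang_interior, of j i b'] by simp
    have "y ! 0 \<le> r" "y ! 1 \<le> r" using sum by linarith+
    then have "?dv f ! 0 = y ! 0" "?dv f ! 1 = y ! 1"
      using inj[OF 0 nth0(1)[OF f\<Sigma>]] inj[OF 1 nth1(1)[OF f\<Sigma>]] by blast+
    then have "?dv f = y"
      using ly length_dvec[of G r ?s "tang_enum G" f ?x]
      by (intro nth_equalityI) (auto simp: val_interior less_2_cases_iff)
    then show "y \<in> dot_array G r \<Sigma> ?x" using f\<Sigma> by (auto simp: dot_array_def)
  qed
qed

end

section \<open>The global slope structure\<close>

lemma SR_slope_structure:
  fixes G :: "('v,'e) mgraph"
  assumes mg: "metric_graph G" and D: "is_divisor G D" and SR: "SR G D r \<Sigma>"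
  shows "\<exists>V. slope_structure G r V (slope_enum G \<Sigma>) (tang_enum G) (\<lambda>x. nondom (dot_array G r \<Sigma> x))"
proof -
  obtain F where F: "finite F" "F \<noteq> {}" "\<And>f. f \<in> F \<Longrightarrow> is_PL G f" "\<Sigma> = tspan G F" "F \<subseteq> \<Sigma>"
    using TLS_generators[OF mg SR_imp_TLS[OF SR]] by blast
  have fin: "finite (verts G)" "finite (edges G)" using mg by (simp_all add: metric_graph_def)
  have "\<exists>B. finite B \<and> (\<forall>t. 0 < t \<and> t < elen G e \<and> t \<notin> B \<longrightarrow> affine_at f e t)"
    if "f \<in> F" "e \<in> edges G" for f e
    using PL_breakpoints[OF F(3)[OF that(1)] that(2)] unfolding affine_at_def .
  then obtain B where B: "\<And>f e. f \<in> F \<Longrightarrow> e \<in> edges G \<Longrightarrow> finite (B f e)"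
    "\<And>f e t. f \<in> F \<Longrightarrow> e \<in> edges G \<Longrightarrow> 0 < t \<Longrightarrow> t < elen G e \<Longrightarrow> t \<notin> B f e \<Longrightarrow> affine_at f e t"
    by metis
  \<comment> \<open>With all vertices in \<open>V\<close>, local constancy has to be checked only at
    interior points where every generator is affine. The restriction to \<open>pts G\<close>
    discards parameters in \<open>B f e\<close> outside the open edge.\<close>
  define V where "V = GV ` verts G \<union> {x \<in> pts G. \<exists>f\<in>F. \<exists>e\<in>edges G. \<exists>t\<in>B f e. x = GE e t}"
  have V: "finite V" "V \<subseteq> pts G"
  proof -
    have "{x \<in> pts G. \<exists>f\<in>F. \<exists>e\<in>edges G. \<exists>t\<in>B f e. x = GE e t} \<subseteq> (\<Union>f\<in>F. \<Union>e\<in>edges G. GE e ` B f e)"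
      by blast
    moreover have "finite (\<Union>f\<in>F. \<Union>e\<in>edges G. GE e ` B f e :: ('v,'e) gpt set)"
      using F(1) fin B(1) by auto
    ultimately show "finite V" using fin finite_subset by (auto simp: V_def)
  qed (auto simp: V_def pts_def)
  have off: "affine_at f e t" if "e \<in> edges G" "0 < t" "t < elen G e" "GE e t \<notin> V" "f \<in> F" for e t f
  proof -
    have "t \<notin> B f e" using that by (auto simp: V_def pts_def)
    then show ?thesis using B(2) that by blast
  qed
  have offE: "\<exists>e t. x = GE e t \<and> e \<in> edges G \<and> 0 < t \<and> t < elen G e" if "x \<in> pts G - V" for x
    using that by (auto simp: V_def pts_def)
  have ends: "GV (etl G e) \<in> V" "GV (ehd G e) \<in> V" if "e \<in> edges G" for e
    using that mg by (auto simp: V_def metric_graph_def)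
  note ctx = mg D SR F
  have "slope_structure G r V (slope_enum G \<Sigma>) (tang_enum G) (\<lambda>x. nondom (dot_array G r \<Sigma> x))"
    unfolding slope_structure_def
  proof (intro conjI ballI allI impI)
    show "x \<in> V" if "x \<in> pts G" "val G x \<noteq> 2" for x
      using offE[of x] that val_interior by fastforce
    show "strict_mono_on {0..r} (slope_enum G \<Sigma> \<eta>)" if "x \<in> pts G" "\<eta> \<in> tang G x" for x \<eta>
      using slope_enum(1)[OF mg D SR that] .
    show "bij_betw (tang_enum G x) {0..<val G x} (tang G x)" for x
      using tang_enum[OF mg] .
    show "perm_array r (val G x) (nondom (dot_array G r \<Sigma> x))" if "x \<in> pts G" for x
      using perm_array_dot_array[OF mg D SR that] .
    show "\<forall>\<^sub>F t' in at t. Sset r (slope_enum G \<Sigma>) (GE e t', b, e) = Sset r (slope_enum G \<Sigma>) (GE e t, b, e)"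
      if "e \<in> edges G" "0 < t \<and> t < elen G e \<and> GE e t \<notin> V" for e t b
      using Sset_locally_constant[OF ctx] off that by blast
    show "slope_enum G \<Sigma> \<eta> i + slope_enum G \<Sigma> \<xi> (r - i) = 0"
      if x: "x \<in> pts G - V" and t: "\<eta> \<in> tang G x" "\<xi> \<in> tang G x" "\<eta> \<noteq> \<xi>" and i: "i \<le> r" for x \<eta> \<xi> i
    proof -
      obtain e t where et: "x = GE e t" "e \<in> edges G" "0 < t" "t < elen G e" using offE[OF x] by blast
      obtain b where "\<eta> = (x, b, e)" "\<xi> = (x, \<not> b, e)" using t et by (auto simp: tang_def)
      then show ?thesis
        using slope_enum_opposite[OF ctx et(2-4) _ i, of b] off[OF et(2-4)] x et(1) by simp
    qed
    show "nondom (dot_array G r \<Sigma> x) = std_perm r 2" if x: "x \<in> pts G - V" for x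
    proof -
      obtain e t where et: "x = GE e t" "e \<in> edges G" "0 < t" "t < elen G e" using offE[OF x] by blast
      then show ?thesis using nondom_dot_array_interior[OF ctx et(2-4)] off[OF et(2-4)] x by simp
    qed
  qed (use V ends in auto)
  then show ?thesis by blast
qed

theorem theorem1p1:
  fixes G :: "('v,'e) mgraph" and D :: "('v,'e) gpt \<Rightarrow> int"
    and \<Sigma> :: "(('v,'e) gpt \<Rightarrow> real) set" and r :: nat
  assumes "metric_graph G"
    and "effective G D"
    and "\<Sigma> \<subseteq> RD G D"
    and "SR G D r \<Sigma>"
  shows "CLLS G D r \<Sigma>"
proof -
  note mg = assms(1) and SR = assms(4)
  note tls = SR_imp_TLS[OF SR]
  have D: "is_divisor G D" using assms(2) by (simp add: effective_def)
  obtain F where F: "finite F" "F \<noteq> {}" "\<And>f. f \<in> F \<Longrightarrow> is_PL G f" "\<Sigma> = tspan G F" "F \<subseteq> \<Sigma>"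
    using TLS_generators[OF mg tls] by blast
  let ?S = "slope_enum G \<Sigma>" and ?P = "\<lambda>x. nondom (dot_array G r \<Sigma> x)"
  obtain V where V: "slope_structure G r V ?S (tang_enum G) ?P"
    using SR_slope_structure[OF mg D SR] by blast
  have "\<Sigma> \<subseteq> RDS G D r ?S (tang_enum G) ?P"
    using compatible_dot_array[OF mg D SR] assms(3) by (auto simp: RDS_def)
  moreover have "\<forall>E. effective G E \<and> deg E = int r \<longrightarrow>
      (\<exists>f\<in>\<Sigma>. bnrp G D f E \<and> (\<forall>x\<in>pts G. E x \<le> rho G r ?S (tang_enum G) ?P f x))"
  proof (intro allI impI)
    fix E assume "effective G E \<and> deg E = int r"
    then have E: "effective G E" "deg E = int r" by auto
    obtain f where f: "f \<in> \<Sigma>" "bnrp G D f E" and attained: "\<And>x. E x \<noteq> 0 \<Longrightarrow> \<exists>M\<subseteq>\<Sigma>. finite M \<and>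
        (\<forall>g\<in>M. \<forall>\<xi>\<in>tang G x. islope G f \<xi> \<le> islope G g \<xi>) \<and>
        nat (E x) < card ((\<lambda>g. islope G g (tang_enum G x 0)) ` M)"
      \<comment> \<open>The chips are dispersed along the tangent direction of index 0 because
        \<open>rank_arr\<close> reads coordinate 0.\<close>
      using TLS_rank_function[OF mg tls D E, of "\<lambda>x. tang_enum G x 0",
          OF tang_enum_mem[OF mg val_pos[OF mg]]] by auto
    have "E x \<le> rho G r ?S (tang_enum G) ?P f x" if x: "x \<in> pts G" for x
    proof (cases "E x = 0")
      case True
      \<comment> \<open>f itself supplies one value, so the rank is nonnegative; this is enough
        where \<open>E\<close> vanishes.\<close>
      then show ?thesis using rho_ge[OF mg D SR x f(1), of "{f}"] f(1) by simp
    next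
      case False
      obtain M where M: "M \<subseteq> \<Sigma>" "\<forall>g\<in>M. \<forall>\<xi>\<in>tang G x. islope G f \<xi> \<le> islope G g \<xi>"
        "nat (E x) < card ((\<lambda>g. islope G g (tang_enum G x 0)) ` M)"
        using attained[OF False] by (elim exE conjE)
      then show ?thesis using rho_ge[OF mg D SR x f(1) M(1,2)] by linarith
    qed
    then show "\<exists>f\<in>\<Sigma>. bnrp G D f E \<and> (\<forall>x\<in>pts G. E x \<le> rho G r ?S (tang_enum G) ?P f x)"
      using f by blast
  qed
  moreover have "sup_closed G \<Sigma>"
    unfolding sup_closed_def F(4) using tspan_sup_closed[OF mg F(1-3)] by blast
  moreover have \<Sigma>: "trop_submodule G \<Sigma>" "fin_gen G \<Sigma>"
    "\<forall>S. S \<subseteq> \<Sigma> \<and> finite S \<and> card S = r + 2 \<longrightarrow> trop_dep G S"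
    using tls by (simp_all add: TLS_def)
  ultimately have "admissible G D r \<Sigma>"
    unfolding admissible_def using assms(3) V
    by (intro conjI exI[of _ V] exI[of _ ?S] exI[of _ "tang_enum G"] exI[of _ ?P])
  then show ?thesis unfolding CLLS_def using assms(3) \<Sigma> by (intro conjI)
qed

end
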